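(* Let $\alpha>2$, let $X=(x_{ij})$ be the $N\times n$ random matrix described in the context, with tail exponent $\alpha$, and suppose that $\mathbb E x_{11}^2=1$ and that $x_{11}$ is symmetrically distributed. Let $\mathfrak u$ be the bottom singular vector of $X$. Then for any $K>0$ there exist constants $\epsilon_{\mathsf a},\delta_{\mathsf a}\in(0,1/2)$ such that the following holds with probability at least $1-O(n^{-K})$: for $\epsilon\in(0,\epsilon_{\mathsf a})$, we have $\|\mathfrak u_I\|_2\ge\delta_{\mathsf a}$ for all $I\subset\{1,2,\dots,n\}$ with $|I|=\lceil(1-\epsilon)n\rceil$.
   Context: Model: $\mathsf a>1$ is a constant, $N=\lceil \mathsf a n\rceil$, and $X=(x_{ij})$ is an $N\times n$ real random matrix with i.i.d. entries whose law does not depend on $n$ and satisfies, for some constants $\alpha,C_\ell,C_u,T_0>0$, $C_\ell t^{-\alpha}\le \mathbb P\{|x_{11}|>t\}\le C_u t^{-\alpha}$ for all $t\ge T_0$. "Symmetrically distributed" means $x_{11}$ and $-x_{11}$ have the same law. The bottom singular vector $\mathfrak u$ is the unit (in $\ell^2$) right singular vector of $X$ corresponding to the smallest singular value $s_{\min}(X)=\inf_{\|u\|_2=1}\|Xu\|_2$. Notation: for $x\in\mathbb R^n$ and $I\subseteq\{1,\dots,n\}$, $x_I\in\mathbb R^{|I|}$ is obtained by deleting the components with indices in $I^c$. The model ($\mathsf a$ and the law of $x_{11}$) is fixed and asymptotics are as $n\to\infty$; constants do not depend on $n$. *)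

theory Defs
  imports "HOL-Probability.Probability"
begin

text \<open>
  A vector of length n is a function on the indices below n, and an N by n matrix a function
  of a row index below N and a column index below n; values at other indices are irrelevant.
  The Euclidean norm of the subvector of u with index set I is \<^term>\<open>L2_set u I\<close>.
\<close>

definition mat_vec :: "nat \<Rightarrow> (nat \<Rightarrow> nat \<Rightarrow> real) \<Rightarrow> (nat \<Rightarrow> real) \<Rightarrow> nat \<Rightarrow> real" where
  "mat_vec n A u = (\<lambda>i. \<Sum>j<n. A i j * u j)"

definition s_min :: "nat \<Rightarrow> nat \<Rightarrow> (nat \<Rightarrow> nat \<Rightarrow> real) \<Rightarrow> real" where
  "s_min N n A = (INF u\<in>{u. L2_set u {..<n} = 1}. L2_set (mat_vec n A u) {..<N})"

definition right_singular_vector ::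
    "nat \<Rightarrow> nat \<Rightarrow> (nat \<Rightarrow> nat \<Rightarrow> real) \<Rightarrow> real \<Rightarrow> (nat \<Rightarrow> real) \<Rightarrow> bool" where
  "right_singular_vector N n A s u \<longleftrightarrow>
     L2_set u {..<n} = 1 \<and>
     (\<exists>v. L2_set v {..<N} = 1 \<and>
          (\<forall>i<N. mat_vec n A u i = s * v i) \<and>
          (\<forall>j<n. mat_vec N (\<lambda>j i. A i j) v j = s * u j))"

text \<open>
  The bottom singular vector is determined at best up to sign, so it is treated as a
  predicate.
\<close>

definition bottom_singular_vector ::
    "nat \<Rightarrow> nat \<Rightarrow> (nat \<Rightarrow> nat \<Rightarrow> real) \<Rightarrow> (nat \<Rightarrow> real) \<Rightarrow> bool" where
  "bottom_singular_vector N n A u \<longleftrightarrow> right_singular_vector N n A (s_min N n A) u"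

definition iid_matrix ::
    "'w measure \<Rightarrow> real measure \<Rightarrow> nat \<Rightarrow> nat \<Rightarrow> (nat \<Rightarrow> nat \<Rightarrow> 'w \<Rightarrow> real) \<Rightarrow> bool" where
  "iid_matrix M \<mu> N n X \<longleftrightarrow>
     prob_space M \<and>
     prob_space.indep_vars M (\<lambda>_. borel) (\<lambda>(i, j). X i j) ({..<N} \<times> {..<n}) \<and>
     (\<forall>i<N. \<forall>j<n. distr M borel (X i j) = \<mu>)"

end

theory Submission
  imports Defs "HOL-Real_Asymp.Real_Asymp"
begin

text \<open>
  Two bounds hold outside events of exponentially small probability, and a fixed gap separates them.

  Upper bound: add or skip the columns of \<open>X\<close> one at a time, choosing each sign so that the
  new column is not positively correlated with the current sum. As the next column is independent of that sum,
  a fixed proportion of the steps gains a constant factor of the typical cross term, so the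
  resulting sign vector gives \<open>s_min\<^sup>2 \<le> (a - c\<^sub>1) n\<close>. Columns of large norm are skipped, because
  heavy tails rule out controlling all of them.

  Lower bound: let \<open>u\<close> be a unit vector whose restriction to \<open>I\<close> has norm below \<open>\<delta>\<close>, where \<open>I\<close> misses
  at most \<open>\<epsilon> n\<close> coordinates. Replace \<open>X\<close> by the rows of norm at most \<open>sqrt (C n)\<close>, and round \<open>u\<close>
  to the lattice of mesh \<open>\<gamma> / sqrt n\<close> at random. On the truncated matrix this changes \<open>\<parallel>X u\<parallel>\<^sup>2\<close> by little
  without any bound on the operator norm of \<open>X\<close>, and it produces sparse lattice vectors, of which there are only
  \<open>exp (\<rho> n)\<close>. A union bound gives \<open>\<parallel>X u\<parallel>\<^sup>2 > (a - c\<^sub>1) n\<close>, whereas \<open>\<parallel>X u\<parallel> = s_min\<close> for a bottom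
  singular vector.
\<close>

subsection \<open>Rounding to sparse lattice vectors\<close>

text \<open>A fixed unit vector has a squared image of mean N, about a n. Heavy tails spoil its
  upper deviations, but a sum of nonnegative terms keeps an exponentially small lower tail, because
  each term has a bounded minorant. Every exponential deviation estimate here has this one-sided
  form, \<open>adapted_lower_tail\<close>. The Chernoff rate obtained is a small constant, so a
  union bound over all lattice vectors of the relevant size would fail. Smallness of u on I makes
  the rounded vector sparse, which brings the count below that rate. In the upper bound the running
  sum reaches length of order n, so a good step saves order n; order n such steps save order n^2,
  and dividing by the at most n columns used leaves order n. The length of the running sum is
  bounded below through the smallest singular value itself, so the argument runs by contradiction
  from that value being large. The gap \<open>c\<^sub>1\<close> comes from the upper bound; the
  constants of the lower bound are then tuned to lose at most half of it.\<close>

text \<open>With weights \<open>1 - p\<close> and \<open>p\<close> on the two lattice neighbours of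
  \<open>u\<close>, the mean position is \<open>u\<close>, the mean of the quadratic form exceeds
  its value at \<open>u\<close> by the variance term, and the mean penalty is unchanged. One
  neighbour is no worse than this average. Form and penalty are added so that one choice controls
  both.\<close>

lemma exists_rounded_coordinate:
  fixes b c :: "nat \<Rightarrow> real"
  assumes "h > 0" "\<beta> \<ge> 0"
  shows "\<exists>k::int. \<bar>h * k - u\<bar> \<le> h \<and>
    (\<Sum>i<N. (b i + c i * (h * k))\<^sup>2) + \<beta> * \<bar>h * k\<bar>
      \<le> (\<Sum>i<N. (b i + c i * u)\<^sup>2) + \<beta> * \<bar>u\<bar> + h\<^sup>2 * (\<Sum>i<N. (c i)\<^sup>2)"
proof -
  define k where "k = \<lfloor>u / h\<rfloor>"
  define p where "p = u / h - k"
  have p: "0 \<le> p" "p \<le> 1" unfolding p_def k_def by linarith+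
  have u: "u = h * k + h * p" using assms by (simp add: p_def field_simps)
  define Q where "Q d = (\<Sum>i<N. (b i + c i * d)\<^sup>2)" for d
  define G where "G d = Q d + \<beta> * \<bar>d\<bar>" for d
  define V where "V = h\<^sup>2 * (\<Sum>i<N. (c i)\<^sup>2)"
  have V: "V \<ge> 0" unfolding V_def by (intro mult_nonneg_nonneg sum_nonneg) auto
  have Q: "(1 - p) * Q (h * k) + p * Q (h * (k + 1)) = Q u + p * (1 - p) * V"
    unfolding Q_def V_def u sum_distrib_left sum.distrib[symmetric]
    by (intro sum.cong refl) (simp add: power2_eq_square algebra_simps)
  \<comment> \<open>Zero is a lattice point, so the absolute value is affine on each lattice
    cell.\<close>
  have abs: "(1 - p) * \<bar>h * k\<bar> + p * \<bar>h * (k + 1)\<bar> = \<bar>u\<bar>"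
  proof (cases "k \<ge> 0")
    case True
    then have "h * k \<ge> 0" "h * (k + 1) \<ge> 0" "u \<ge> 0" using assms p u by auto
    then show ?thesis unfolding u by (simp add: algebra_simps)
  next
    case False
    then have "real_of_int k + 1 \<le> 0" by linarith
    then have "h * k \<le> 0" "h * (k + 1) \<le> 0" using assms by (auto simp: mult_le_0_iff)
    moreover have "u \<le> h * (k + 1)" unfolding u using p assms by (simp add: algebra_simps)
    ultimately have "u \<le> 0" by linarith
    with \<open>h * k \<le> 0\<close> \<open>h * (k + 1) \<le> 0\<close> show ?thesis unfolding u by (simp add: algebra_simps)
  qed
  have avg: "(1 - p) * G (h * k) + p * G (h * (k + 1)) = Q u + \<beta> * \<bar>u\<bar> + p * (1 - p) * V"
    using Q abs unfolding G_def by (simp add: algebra_simps flip: abs)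
  have "p * (1 - p) \<le> 1" using p mult_mono[of p 1 "1 - p" 1] by simp
  then have "p * (1 - p) * V \<le> V" using V mult_right_mono[of "p * (1 - p)" 1 V] by simp
  then have le: "(1 - p) * G (h * k) + p * G (h * (k + 1)) \<le> Q u + \<beta> * \<bar>u\<bar> + V" using avg by simp
  have "G (h * k) \<le> Q u + \<beta> * \<bar>u\<bar> + V \<or> G (h * (k + 1)) \<le> Q u + \<beta> * \<bar>u\<bar> + V"
  proof (rule ccontr)
    assume "\<not> ?thesis"
    then have "- G (h * k) < - (Q u + \<beta> * \<bar>u\<bar> + V)" "- G (h * (k + 1)) < - (Q u + \<beta> * \<bar>u\<bar> + V)"
      by auto
    then have "(1 - p) * - G (h * k) + p * - G (h * (k + 1)) < - (Q u + \<beta> * \<bar>u\<bar> + V)"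
      using p by (intro convex_bound_lt) auto
    with le show False by simp
  qed
  moreover have "\<bar>h * k - u\<bar> \<le> h" "\<bar>h * (k + 1) - u\<bar> \<le> h"
    using p assms mult_left_mono[of p 1 h] mult_nonneg_nonneg[of h p] unfolding u
    by (simp_all add: algebra_simps abs_le_iff del: mult_nonneg_nonneg)
  ultimately obtain l :: int where "\<bar>h * l - u\<bar> \<le> h" "G (h * l) \<le> Q u + \<beta> * \<bar>u\<bar> + V"
    using of_int_add[of k 1] by (metis of_int_1)
  then show ?thesis unfolding G_def Q_def V_def by blast
qed

text \<open>
  Derandomised random rounding: rounding each coordinate up or down at random, with mean
  preserved, adds only a variance term to the quadratic form.
\<close>

lemma exists_rounding:
  fixes A :: "nat \<Rightarrow> nat \<Rightarrow> real" and u :: "nat \<Rightarrow> real"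
  assumes "h > 0" "\<And>j. \<beta> j \<ge> 0"
  shows "\<exists>k::nat \<Rightarrow> int. (\<forall>j<n. \<bar>h * k j - u j\<bar> \<le> h) \<and>
    (\<Sum>i<N. (b i + (\<Sum>j<n. A i j * (h * k j)))\<^sup>2) + (\<Sum>j<n. \<beta> j * \<bar>h * k j\<bar>)
      \<le> (\<Sum>i<N. (b i + (\<Sum>j<n. A i j * u j))\<^sup>2) + (\<Sum>j<n. \<beta> j * \<bar>u j\<bar>)
        + h\<^sup>2 * (\<Sum>j<n. \<Sum>i<N. (A i j)\<^sup>2)"
\<comment> \<open>The offset \<open>b\<close> is generalised so that the still unrounded last
  coordinate can be absorbed into it when the first \<open>n\<close> coordinates are
  rounded.\<close>
proof (induction n arbitrary: b)
  case (Suc n)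
  obtain k :: "nat \<Rightarrow> int" where k: "\<forall>j<n. \<bar>h * k j - u j\<bar> \<le> h"
    "(\<Sum>i<N. (b i + A i n * u n + (\<Sum>j<n. A i j * (h * k j)))\<^sup>2) + (\<Sum>j<n. \<beta> j * \<bar>h * k j\<bar>)
      \<le> (\<Sum>i<N. (b i + A i n * u n + (\<Sum>j<n. A i j * u j))\<^sup>2) + (\<Sum>j<n. \<beta> j * \<bar>u j\<bar>)
        + h\<^sup>2 * (\<Sum>j<n. \<Sum>i<N. (A i j)\<^sup>2)"
    using Suc.IH[of "\<lambda>i. b i + A i n * u n"] by auto
  obtain l :: int where l: "\<bar>h * l - u n\<bar> \<le> h"
    "(\<Sum>i<N. (b i + (\<Sum>j<n. A i j * (h * k j)) + A i n * (h * l))\<^sup>2) + \<beta> n * \<bar>h * l\<bar>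
      \<le> (\<Sum>i<N. (b i + (\<Sum>j<n. A i j * (h * k j)) + A i n * u n)\<^sup>2) + \<beta> n * \<bar>u n\<bar>
        + h\<^sup>2 * (\<Sum>i<N. (A i n)\<^sup>2)"
    using exists_rounded_coordinate[OF assms(1) assms(2)[of n], where u = "u n" and N = N and
        b = "\<lambda>i. b i + (\<Sum>j<n. A i j * (h * k j))" and c = "\<lambda>i. A i n"] by auto
  define k' where "k' = k(n := l)"
  have 0: "\<forall>j<Suc n. \<bar>h * k' j - u j\<bar> \<le> h" using k(1) l(1) by (auto simp: k'_def less_Suc_eq)
  have 1: "(\<Sum>j<Suc n. A i j * (h * k' j)) = (\<Sum>j<n. A i j * (h * k j)) + A i n * (h * l)" for i
    by (simp add: k'_def)
  have 2: "(\<Sum>j<Suc n. \<beta> j * \<bar>h * k' j\<bar>) = (\<Sum>j<n. \<beta> j * \<bar>h * k j\<bar>) + \<beta> n * \<bar>h * l\<bar>"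
    by (simp add: k'_def)
  have 3: "(\<Sum>i<N. (b i + (\<Sum>j<Suc n. A i j * (h * k' j)))\<^sup>2) + (\<Sum>j<Suc n. \<beta> j * \<bar>h * k' j\<bar>)
      \<le> (\<Sum>i<N. (b i + (\<Sum>j<Suc n. A i j * u j))\<^sup>2) + (\<Sum>j<Suc n. \<beta> j * \<bar>u j\<bar>)
        + h\<^sup>2 * (\<Sum>j<Suc n. \<Sum>i<N. (A i j)\<^sup>2)"
  proof -
    have "(\<Sum>i<N. (b i + (\<Sum>j<n. A i j * (h * k j)) + A i n * u n)\<^sup>2)
        = (\<Sum>i<N. (b i + A i n * u n + (\<Sum>j<n. A i j * (h * k j)))\<^sup>2)"
      by (simp only: add_ac)
    moreover have "(\<Sum>i<N. (b i + A i n * u n + (\<Sum>j<n. A i j * u j))\<^sup>2)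
        = (\<Sum>i<N. (b i + (\<Sum>j<Suc n. A i j * u j))\<^sup>2)"
      by (simp add: add_ac)
    moreover have "(\<Sum>i<N. (b i + (\<Sum>j<n. A i j * (h * k j)) + A i n * (h * l))\<^sup>2)
        = (\<Sum>i<N. (b i + (\<Sum>j<Suc n. A i j * (h * k' j)))\<^sup>2)"
      unfolding 1 by (simp add: add_ac)
    moreover have "h\<^sup>2 * (\<Sum>j<Suc n. \<Sum>i<N. (A i j)\<^sup>2)
        = h\<^sup>2 * (\<Sum>j<n. \<Sum>i<N. (A i j)\<^sup>2) + h\<^sup>2 * (\<Sum>i<N. (A i n)\<^sup>2)"
      by (simp add: distrib_left)
    moreover have "(\<Sum>j<Suc n. \<beta> j * \<bar>u j\<bar>) = (\<Sum>j<n. \<beta> j * \<bar>u j\<bar>) + \<beta> n * \<bar>u n\<bar>" by simp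
    ultimately show ?thesis using k(2) l(2) 2 by linarith
  qed
  show ?case using 0 3 by blast
qed auto

text \<open>One-coordinate generating function for the lattice count: a geometric series on each
  side of 0, with \<open>z\<close> charged once for a nonzero value. The bound does not depend on
  \<open>M\<close>.\<close>

lemma sum_exp_abs_le:
  fixes t :: real
  assumes "t > 0"
  shows "(\<Sum>k\<in>{-int M..int M}. exp (- t * \<bar>real_of_int k\<bar>) * (if k = 0 then 1 else z))
    \<le> 1 + 2 * \<bar>z\<bar> / (1 - exp (- t))"
proof -
  define f where "f k = exp (- t * \<bar>real_of_int k\<bar>) * (if k = 0 then 1 else z)" for k
  have g: "(\<Sum>k\<in>{1..M}. exp (- t) ^ k) \<le> 1 / (1 - exp (- t))"
  proof -
    have "(\<Sum>k\<in>{1..M}. exp (- t) ^ k) \<le> (\<Sum>k. exp (- t) ^ k)"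
      using assms by (intro sum_le_suminf summable_geometric) auto
    also have "\<dots> = 1 / (1 - exp (- t))" using assms by (intro suminf_geometric) auto
    finally show ?thesis .
  qed
  have eq: "{-int M..int M} = insert 0 (int ` {1..M} \<union> (\<lambda>k. - int k) ` {1..M})"
  proof (intro equalityI subsetI)
    fix k assume "k \<in> {-int M..int M}"
    then show "k \<in> insert 0 (int ` {1..M} \<union> (\<lambda>k. - int k) ` {1..M})"
      by (cases k rule: int_cases3) (auto simp: image_iff)
  qed auto
  have "(\<Sum>k\<in>{-int M..int M}. f k) = f 0 + ((\<Sum>k\<in>int ` {1..M}. f k) + (\<Sum>k\<in>(\<lambda>k. - int k) ` {1..M}. f k))"
    unfolding eq by (subst sum.insert) (auto intro!: sum.union_disjoint)
  also have "(\<Sum>k\<in>int ` {1..M}. f k) = z * (\<Sum>k\<in>{1..M}. exp (- t) ^ k)"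
    by (subst sum.reindex) (auto simp: f_def sum_distrib_left inj_on_def exp_of_nat_mult[symmetric] mult_ac intro!: sum.cong)
  also have "(\<Sum>k\<in>(\<lambda>k. - int k) ` {1..M}. f k) = z * (\<Sum>k\<in>{1..M}. exp (- t) ^ k)"
    by (subst sum.reindex) (auto simp: f_def sum_distrib_left inj_on_def exp_of_nat_mult[symmetric] mult_ac intro!: sum.cong)
  also have "z * (\<Sum>k\<in>{1..M}. exp (- t) ^ k) \<le> \<bar>z\<bar> * (1 / (1 - exp (- t)))"
    using g by (intro mult_mono) (auto intro!: sum_nonneg)
  finally show ?thesis by (simp add: f_def)
qed

text \<open>Extensional functions identify integer vectors that agree below \<open>n\<close>;
  otherwise the set would be infinite.\<close>

definition sparse_lattice :: "real \<Rightarrow> real \<Rightarrow> nat \<Rightarrow> (nat \<Rightarrow> int) set" where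
  "sparse_lattice \<kappa> B n = {k \<in> {..<n} \<rightarrow>\<^sub>E UNIV.
     real (card {j\<in>{..<n}. k j \<noteq> 0}) \<le> \<kappa> * n \<and> (\<Sum>j<n. \<bar>real_of_int (k j)\<bar>) \<le> B * n}"

text \<open>Exponential weighting: every member has product weight at least exp(- 2 \<rho> n / 3),
  while the total weight factorises over coordinates and is at most exp(\<rho> n / 3).\<close>

lemma sparse_lattice_card:
  fixes B \<rho> :: real
  assumes "B > 0" "\<rho> > 0"
  shows "\<exists>\<kappa>>0. \<forall>n. finite (sparse_lattice \<kappa> B n) \<and> real (card (sparse_lattice \<kappa> B n)) \<le> exp (\<rho> * n)"
proof -
  \<comment> \<open>The l1 budget \<open>B * n\<close> then costs exactly \<rho> n / 3 in the
    exponent.\<close>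
  define t where "t = \<rho> / (3 * B)"
  have t: "t > 0" using assms by (simp add: t_def)
  \<comment> \<open>Solves \<open>2 * z / (1 - exp (- t)) = \<rho> / 3\<close>, so one coordinate
    has total weight at most \<open>1 + \<rho> / 3\<close>.\<close>
  define z where "z = \<rho> / 3 * (1 - exp (- t)) / 2"
  have z: "z > 0" using t assms by (simp add: z_def)
  \<comment> \<open>The maximum with 1 keeps \<open>\<tau>\<close> positive even when
    \<open>z \<ge> 1\<close>; the choice of \<open>\<kappa>\<close> below divides by it, so that the
    support budget also costs \<rho> n / 3.\<close>
  define \<tau> where "\<tau> = max 1 (- ln z)"
  define y where "y = exp (- \<tau>)"
  have y: "0 < y" "y \<le> z" unfolding y_def \<tau>_def using z by (auto simp: exp_le_cancel_iff[symmetric, of _ "ln z"] simp flip: exp_ln_iff) (metis exp_le_cancel_iff exp_ln max.cobounded2 minus_le_iff)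
  define \<kappa> where "\<kappa> = \<rho> / (3 * \<tau>)"
  have \<tau>: "\<tau> \<ge> 1" by (simp add: \<tau>_def)
  have \<kappa>: "\<kappa> > 0" using \<tau> assms by (simp add: \<kappa>_def)
  define w where "w k = exp (- t * \<bar>real_of_int k\<bar>) * (if k = 0 then 1 else y)" for k :: int
  have w: "w k > 0" for k using y by (simp add: w_def)
  have "finite (sparse_lattice \<kappa> B n) \<and> real (card (sparse_lattice \<kappa> B n)) \<le> exp (\<rho> * n)" for n
  proof -
    define M where "M = nat \<lceil>B * n\<rceil>"
    define L where "L = ({..<n} \<rightarrow>\<^sub>E {-int M..int M})"
    have fL: "finite L" unfolding L_def by (intro finite_PiE) auto
    have sub: "sparse_lattice \<kappa> B n \<subseteq> L"
    proof
      fix k assume k: "k \<in> sparse_lattice \<kappa> B n"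
      have "k j \<in> {-int M..int M}" if "j < n" for j
      proof -
        have "\<bar>real_of_int (k j)\<bar> \<le> (\<Sum>j<n. \<bar>real_of_int (k j)\<bar>)"
          using that by (intro member_le_sum) auto
        also have "\<dots> \<le> B * n" using k by (simp add: sparse_lattice_def)
        also have "\<dots> \<le> real M" unfolding M_def by linarith
        finally have "\<bar>k j\<bar> \<le> int M" by linarith
        then show ?thesis by auto
      qed
      then show "k \<in> L" using k by (auto simp: L_def sparse_lattice_def PiE_iff)
    qed
    have one: "1 \<le> exp (2 * \<rho> / 3 * n) * (\<Prod>j<n. w (k j))" if k: "k \<in> sparse_lattice \<kappa> B n" for k
    proof -
      have "(\<Prod>j<n. w (k j)) = exp (- t * (\<Sum>j<n. \<bar>real_of_int (k j)\<bar>)) * (\<Prod>j<n. if k j = 0 then 1 else y)"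
        unfolding w_def prod.distrib by (simp add: exp_sum sum_distrib_left)
      also have "(\<Prod>j<n. if k j = 0 then 1 else y) = y ^ card {j\<in>{..<n}. k j \<noteq> 0}"
        by (subst prod.If_cases) (auto simp: Collect_neg_eq[symmetric] Int_def)
      also have "\<dots> = exp (- \<tau> * card {j\<in>{..<n}. k j \<noteq> 0})" unfolding y_def by (simp add: exp_of_nat_mult[symmetric] mult_ac)
      finally have eq: "(\<Prod>j<n. w (k j)) = exp (- t * (\<Sum>j<n. \<bar>real_of_int (k j)\<bar>) - \<tau> * card {j\<in>{..<n}. k j \<noteq> 0})"
        by (simp add: exp_add[symmetric])
      have "t * (\<Sum>j<n. \<bar>real_of_int (k j)\<bar>) \<le> t * (B * n)"
        using k t by (intro mult_left_mono) (auto simp: sparse_lattice_def)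
      moreover have "t * (B * n) = \<rho> / 3 * n" using assms by (simp add: t_def)
      moreover have "\<tau> * card {j\<in>{..<n}. k j \<noteq> 0} \<le> \<tau> * (\<kappa> * n)"
        using k \<tau> by (intro mult_left_mono) (auto simp: sparse_lattice_def)
      moreover have "\<tau> * (\<kappa> * n) = \<rho> / 3 * n" using \<tau> by (simp add: \<kappa>_def)
      ultimately have "0 \<le> 2 * \<rho> / 3 * n + (- t * (\<Sum>j<n. \<bar>real_of_int (k j)\<bar>) - \<tau> * card {j\<in>{..<n}. k j \<noteq> 0})"
        by simp
      then show ?thesis unfolding eq exp_add[symmetric] one_le_exp_iff .
    qed
    have "real (card (sparse_lattice \<kappa> B n)) = (\<Sum>k\<in>sparse_lattice \<kappa> B n. 1)" by simp
    also have "\<dots> \<le> (\<Sum>k\<in>sparse_lattice \<kappa> B n. exp (2 * \<rho> / 3 * n) * (\<Prod>j<n. w (k j)))"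
      by (intro sum_mono one)
    also have "\<dots> \<le> (\<Sum>k\<in>L. exp (2 * \<rho> / 3 * n) * (\<Prod>j<n. w (k j)))"
      using sub fL w by (intro sum_mono2) (auto intro!: mult_nonneg_nonneg prod_nonneg simp: less_imp_le)
    also have "\<dots> = exp (2 * \<rho> / 3 * n) * (\<Sum>k\<in>L. (\<Prod>j<n. w (k j)))" by (simp add: sum_distrib_left)
    also have "(\<Sum>k\<in>L. (\<Prod>j<n. w (k j))) = (\<Prod>j<n. \<Sum>k\<in>{-int M..int M}. w k)"
      unfolding L_def by (subst prod_sum_PiE) auto
    also have "\<dots> = (\<Sum>k\<in>{-int M..int M}. w k) ^ n" by simp
    also have "\<dots> \<le> exp (\<rho> / 3) ^ n"
    proof (intro power_mono)
      have "(\<Sum>k\<in>{-int M..int M}. w k) \<le> 1 + 2 * \<bar>y\<bar> / (1 - exp (- t))"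
        unfolding w_def using sum_exp_abs_le[OF t] .
      also have "2 * \<bar>y\<bar> / (1 - exp (- t)) \<le> 2 * z / (1 - exp (- t))"
        using y t by (intro divide_right_mono) auto
      also have "\<dots> = \<rho> / 3" using t by (simp add: z_def field_simps)
      also have "1 + \<rho> / 3 \<le> exp (\<rho> / 3)" by (rule exp_ge_add_one_self)
      finally show "(\<Sum>k\<in>{-int M..int M}. w k) \<le> exp (\<rho> / 3)" by simp
    qed (use w in \<open>auto intro!: sum_nonneg simp: less_imp_le\<close>)
    also have "exp (2 * \<rho> / 3 * n) * exp (\<rho> / 3) ^ n = exp (\<rho> * n)"
      by (simp add: exp_of_nat_mult[symmetric] exp_add[symmetric] field_simps)
    finally show ?thesis using finite_subset[OF sub fL] by simp
  qed
  with \<kappa> show ?thesis by blast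
qed

subsection \<open>Greedy signs\<close>

text \<open>The value 0 skips a column of large norm. A vanishing inner product gives 1 rather than
  0, so that the squares of the signs count exactly the columns used.\<close>

definition greedy_sign :: "nat \<Rightarrow> real \<Rightarrow> (nat \<Rightarrow> real) \<Rightarrow> (nat \<Rightarrow> real) \<Rightarrow> real" where
  "greedy_sign N B y c =
     (if (\<Sum>i<N. (c i)\<^sup>2) \<le> B then (if (\<Sum>i<N. y i * c i) > 0 then -1 else 1) else 0)"

primrec greedy_sum :: "nat \<Rightarrow> real \<Rightarrow> (nat \<Rightarrow> nat \<Rightarrow> real) \<Rightarrow> nat \<Rightarrow> nat \<Rightarrow> real" where
  "greedy_sum N B x 0 = (\<lambda>i. 0)"
| "greedy_sum N B x (Suc k) =
     (\<lambda>i. greedy_sum N B x k i + greedy_sign N B (greedy_sum N B x k) (x k) * x k i)"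

text \<open>For independent centred entries of unit variance the inner product with a fixed
  \<open>y\<close> has the length of \<open>y\<close> as standard deviation; a hit is a usable
  column that reaches half of it.\<close>

definition greedy_hit :: "nat \<Rightarrow> real \<Rightarrow> (nat \<Rightarrow> real) \<Rightarrow> (nat \<Rightarrow> real) \<Rightarrow> bool" where
  "greedy_hit N B y c \<longleftrightarrow> (\<Sum>i<N. (c i)\<^sup>2) \<le> B \<and> sqrt (\<Sum>i<N. (y i)\<^sup>2) / 2 \<le> \<bar>\<Sum>i<N. y i * c i\<bar>"

lemma greedy_sum_eq:
  "greedy_sum N B x k i = (\<Sum>l<k. greedy_sign N B (greedy_sum N B x l) (x l) * x l i)"
  by (induction k) auto

text \<open>Dependence on earlier columns only is what makes the hit indicators adapted.\<close>

lemma greedy_sum_cong: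
  "(\<And>l. l < k \<Longrightarrow> x l = x' l) \<Longrightarrow> greedy_sum N B x k = greedy_sum N B x' k"
  by (induction k) auto

text \<open>Using a column adds at most \<open>B\<close> to the squared length, minus twice the
  absolute inner product. After \<open>t\<close> hits at least \<open>t\<close> columns are in use,
  so by \<open>low\<close> the length is at least \<open>s * sqrt t\<close>, and each later hit
  saves that much. Natural subtraction in \<open>e - t\<close> counts no saving before then.\<close>

lemma greedy_sum_bound:
  fixes x :: "nat \<Rightarrow> nat \<Rightarrow> real" and t :: nat
  assumes s: "s \<ge> 0"
    and low: "\<And>w. s\<^sup>2 * (\<Sum>l<n. (w l)\<^sup>2) \<le> (\<Sum>i<N. (\<Sum>l<n. w l * x l i)\<^sup>2)"
    and "k \<le> n"
  shows "(\<Sum>i<N. (greedy_sum N B x k i)\<^sup>2)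
      \<le> (\<Sum>l<k. (greedy_sign N B (greedy_sum N B x l) (x l))\<^sup>2) * B
        - s * sqrt t * real (card {l\<in>{..<k}. greedy_hit N B (greedy_sum N B x l) (x l)} - t)"
    and "real (card {l\<in>{..<k}. greedy_hit N B (greedy_sum N B x l) (x l)})
      \<le> (\<Sum>l<k. (greedy_sign N B (greedy_sum N B x l) (x l))\<^sup>2)"
    and "s\<^sup>2 * (\<Sum>l<k. (greedy_sign N B (greedy_sum N B x l) (x l))\<^sup>2)
      \<le> (\<Sum>i<N. (greedy_sum N B x k i)\<^sup>2)"
proof -
  define y where "y = greedy_sum N B x"
  define \<sigma> where "\<sigma> l = greedy_sign N B (y l) (x l)" for l
  define e where "e k = card {l\<in>{..<k}. greedy_hit N B (y l) (x l)}" for k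
  define m where "m k = (\<Sum>l<k. (\<sigma> l)\<^sup>2)" for k
  define R where "R k = (\<Sum>i<N. (y k i)\<^sup>2)" for k
  have e_Suc: "e (Suc k) = e k + (if greedy_hit N B (y k) (x k) then 1 else 0)" for k
  proof -
    have "{l\<in>{..<Suc k}. greedy_hit N B (y l) (x l)} =
      (if greedy_hit N B (y k) (x k) then insert k {l\<in>{..<k}. greedy_hit N B (y l) (x l)}
       else {l\<in>{..<k}. greedy_hit N B (y l) (x l)})" by (auto simp: less_Suc_eq)
    then show ?thesis by (simp add: e_def)
  qed
  have em: "real (e k) \<le> m k" for k
  proof (induction k)
    case (Suc k)
    then show ?case by (auto simp: e_Suc m_def \<sigma>_def greedy_hit_def greedy_sign_def)
  qed (simp add: e_def m_def)
  \<comment> \<open>A partial sum is a full combination whose coefficients from \<open>k\<close> on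
    are zero, so \<open>low\<close> applies to it.\<close>
  have low': "s\<^sup>2 * m k \<le> R k" if "k \<le> n" for k
  proof -
    have *: "(\<Sum>l<n. (if l < k then g l else 0) * f l) = (\<Sum>l<k. g l * f l)" for f g :: "nat \<Rightarrow> real"
      using that by (intro sum.mono_neutral_cong_right) auto
    have "(\<Sum>l<n. (if l < k then \<sigma> l else 0)\<^sup>2) = m k"
      unfolding m_def using that by (intro sum.mono_neutral_cong_right) auto
    then have "s\<^sup>2 * m k \<le> (\<Sum>i<N. (\<Sum>l<n. (if l < k then \<sigma> l else 0) * x l i)\<^sup>2)"
      using low[of "\<lambda>l. if l < k then \<sigma> l else 0"] by simp
    also have "\<dots> = R k" unfolding * R_def y_def greedy_sum_eq[of N B x k] by (simp add: \<sigma>_def y_def)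
    finally show ?thesis .
  qed
  have up: "R k \<le> m k * B - s * sqrt t * real (e k - t)" if "k \<le> n" for k
    using that
  proof (induction k)
    case (Suc k)
    define d where "d = (\<Sum>i<N. y k i * x k i)"
    define X where "X = (\<Sum>i<N. (x k i)\<^sup>2)"
    have RS: "R (Suc k) = R k + 2 * \<sigma> k * d + (\<sigma> k)\<^sup>2 * X"
      unfolding R_def d_def X_def y_def \<sigma>_def
      by (simp add: power2_sum power_mult_distrib sum.distrib sum_distrib_left sum_distrib_right mult_ac)
    have IH: "R k \<le> m k * B - s * sqrt t * real (e k - t)" using Suc by simp
    show ?case
    proof (cases "X \<le> B")
      case False
      then have "\<sigma> k = 0" "\<not> greedy_hit N B (y k) (x k)"
        by (auto simp: \<sigma>_def greedy_sign_def greedy_hit_def X_def)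
      then show ?thesis using IH RS by (simp add: e_Suc m_def)
    next
      case True
      then have \<sigma>: "(\<sigma> k)\<^sup>2 = 1" "\<sigma> k * d = - \<bar>d\<bar>"
        by (auto simp: \<sigma>_def greedy_sign_def X_def d_def)
      have RS': "R (Suc k) \<le> R k + B - 2 * \<bar>d\<bar>" using RS \<sigma> True by simp
      have mS: "m (Suc k) = m k + 1" using \<sigma> by (simp add: m_def)
      show ?thesis
      \<comment> \<open>Misses and the first \<open>t\<close> hits also lower the squared length or
        leave it below the cap, but their saving is discarded.\<close>
      proof (cases "greedy_hit N B (y k) (x k) \<and> e k \<ge> t")
        case False
        then have "e (Suc k) - t = e k - t" by (auto simp: e_Suc)
        then show ?thesis using IH RS' mS by (simp add: algebra_simps)
      next
        case hit: True
        then have "sqrt (R k) / 2 \<le> \<bar>d\<bar>" by (simp add: greedy_hit_def R_def d_def)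
        moreover have "s * sqrt t \<le> sqrt (R k)"
        proof -
          have "s\<^sup>2 * t \<le> s\<^sup>2 * m k" using hit em[of k] by (intro mult_left_mono) auto
          also have "\<dots> \<le> R k" using low' Suc.prems by simp
          finally have "sqrt (s\<^sup>2 * t) \<le> sqrt (R k)" by simp
          then show ?thesis using s by (simp add: real_sqrt_mult)
        qed
        ultimately have "2 * \<bar>d\<bar> \<ge> s * sqrt t" by linarith
        moreover have "real (e (Suc k) - t) = real (e k - t) + 1" using hit by (simp add: e_Suc)
        ultimately show ?thesis using IH RS' mS by (simp add: algebra_simps)
      qed
    qed
  qed (simp add: R_def m_def e_def y_def)
  show "(\<Sum>i<N. (greedy_sum N B x k i)\<^sup>2)
      \<le> (\<Sum>l<k. (greedy_sign N B (greedy_sum N B x l) (x l))\<^sup>2) * B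
        - s * sqrt t * real (card {l\<in>{..<k}. greedy_hit N B (greedy_sum N B x l) (x l)} - t)"
    using up[OF assms(3)] by (simp add: R_def m_def e_def y_def \<sigma>_def)
  show "real (card {l\<in>{..<k}. greedy_hit N B (greedy_sum N B x l) (x l)})
      \<le> (\<Sum>l<k. (greedy_sign N B (greedy_sum N B x l) (x l))\<^sup>2)"
    using em[of k] by (simp add: m_def e_def y_def \<sigma>_def)
  show "s\<^sup>2 * (\<Sum>l<k. (greedy_sign N B (greedy_sum N B x l) (x l))\<^sup>2)
      \<le> (\<Sum>i<N. (greedy_sum N B x k i)\<^sup>2)"
    using low'[OF assms(3)] by (simp add: R_def m_def y_def \<sigma>_def)
qed

subsection \<open>Lower tails of adapted sums\<close>

lemma exp_minus_le_quadratic: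
  fixes x :: real
  assumes "x \<ge> 0"
  shows "exp (- x) \<le> 1 - x + x\<^sup>2 / 2"
proof -
  have "(\<lambda>x::real. 1 - x + x\<^sup>2 / 2 - exp (- x)) 0 \<le> (\<lambda>x. 1 - x + x\<^sup>2 / 2 - exp (- x)) x"
  proof (rule DERIV_nonneg_imp_nondecreasing[OF assms])
    fix y :: real assume "0 \<le> y" "y \<le> x"
    have "((\<lambda>x. 1 - x + x\<^sup>2 / 2 - exp (- x)) has_real_derivative (- 1 + y + exp (- y))) (at y)"
      by (auto intro!: derivative_eq_intros)
    moreover have "- 1 + y + exp (- y) \<ge> 0" using exp_ge_add_one_self[of "- y"] by linarith
    ultimately show "\<exists>z. ((\<lambda>x. 1 - x + x\<^sup>2 / 2 - exp (- x)) has_real_derivative z) (at y) \<and> 0 \<le> z"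
      by blast
  qed
  then show ?thesis by simp
qed

text \<open>Chernoff bound with Laplace parameter equal to the deviation \<open>r\<close>. Given the
  prefix, \<open>0 \<le> Z \<le> 1\<close> and the mean bound yield the factor
  \<open>\<rho>\<close>; integrating out the last coordinate first multiplies these factors. The
  exponent r m (q - r) - m r q + m r^2 / 2 equals - m r^2 / 2.\<close>

lemma (in prob_space) adapted_lower_tail:
  fixes Z :: "nat \<Rightarrow> (nat \<Rightarrow> 'a) \<Rightarrow> 'a \<Rightarrow> real"
  assumes meas: "\<And>k. (\<lambda>(x, c). Z k x c) \<in> borel_measurable (PiM {..<k} (\<lambda>_. M) \<Otimes>\<^sub>M M)"
    and bounds: "\<And>k x c. 0 \<le> Z k x c" "\<And>k x c. Z k x c \<le> 1"
    and mean: "\<And>k x. x \<in> space (PiM {..<k} (\<lambda>_. M)) \<Longrightarrow> q \<le> (\<integral>c. Z k x c \<partial>M)"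
    and r: "r \<ge> 0"
  shows "measure (PiM {..<m} (\<lambda>_. M))
      {x \<in> space (PiM {..<m} (\<lambda>_. M)). (\<Sum>k<m. Z k (restrict x {..<k}) (x k)) \<le> m * (q - r)}
    \<le> exp (- real m * r\<^sup>2 / 2)"
proof -
  interpret P: product_prob_space "\<lambda>_::nat. M" by unfold_locales
  define S where "S m x = (\<Sum>k<m. Z k (restrict x {..<k}) (x k))" for m x
  have restr[measurable]: "(\<lambda>x. restrict x {..<k}) \<in> measurable (PiM {..<m} (\<lambda>_. M)) (PiM {..<k} (\<lambda>_. M))"
    if "k \<le> m" for k m :: nat
    using that by (intro measurable_restrict_subset) (simp add: lessThan_subset_iff)
  have S_meas[measurable]: "S m \<in> borel_measurable (PiM {..<m} (\<lambda>_. M))" for m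
    unfolding S_def
  proof (intro borel_measurable_sum)
    fix k assume k: "k \<in> {..<m}"
    have "(\<lambda>x. (restrict x {..<k}, x k)) \<in> measurable (PiM {..<m} (\<lambda>_. M)) (PiM {..<k} (\<lambda>_. M) \<Otimes>\<^sub>M M)"
      using k restr[of k m] by (intro measurable_Pair measurable_component_singleton) auto
    from measurable_compose[OF this meas[of k]]
    show "(\<lambda>x. Z k (restrict x {..<k}) (x k)) \<in> borel_measurable (PiM {..<m} (\<lambda>_. M))" by simp
  qed
  define \<rho> where "\<rho> = exp (- r * q + r\<^sup>2 / 2)"
  have inner: "(\<integral>\<^sup>+c. ennreal (exp (- r * Z k x c)) \<partial>M) \<le> ennreal \<rho>"
    if x: "x \<in> space (PiM {..<k} (\<lambda>_. M))" for k x
  proof -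
    have Zm[measurable]: "Z k x \<in> borel_measurable M"
      using measurable_compose[OF measurable_Pair1'[OF x] meas[of k]] by simp
    have int: "integrable M (Z k x)"
      using bounds by (intro integrable_const_bound[where B = 1]) (auto intro!: AE_I2)
    have "(\<integral>\<^sup>+c. ennreal (exp (- r * Z k x c)) \<partial>M) = ennreal (\<integral>c. exp (- r * Z k x c) \<partial>M)"
      using bounds r by (intro nn_integral_eq_integral integrable_const_bound[where B = 1]) (auto intro!: AE_I2)
    also have "(\<integral>c. exp (- r * Z k x c) \<partial>M) \<le> (\<integral>c. 1 + r\<^sup>2 / 2 - r * Z k x c \<partial>M)"
    proof (rule integral_mono)
      show "integrable M (\<lambda>c. exp (- r * Z k x c))"
        using bounds r by (intro integrable_const_bound[where B = 1]) (auto intro!: AE_I2)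
      show "integrable M (\<lambda>c. 1 + r\<^sup>2 / 2 - r * Z k x c)" using int by simp
      fix c
      have "exp (- (r * Z k x c)) \<le> 1 - r * Z k x c + (r * Z k x c)\<^sup>2 / 2"
        using bounds r by (intro exp_minus_le_quadratic) auto
      moreover have "(r * Z k x c)\<^sup>2 \<le> r\<^sup>2"
        using bounds r by (intro power_mono mult_left_le) auto
      ultimately show "exp (- r * Z k x c) \<le> 1 + r\<^sup>2 / 2 - r * Z k x c" by simp
    qed
    also have "\<dots> = 1 + r\<^sup>2 / 2 - r * (\<integral>c. Z k x c \<partial>M)" using int by (simp add: prob_space)
    also have "\<dots> \<le> 1 + (- r * q + r\<^sup>2 / 2)" using mult_left_mono[OF mean[OF x] r] by simp
    also have "\<dots> \<le> \<rho>" unfolding \<rho>_def by (rule exp_ge_add_one_self)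
    finally show ?thesis by (simp add: ennreal_leI)
  qed
  have mgf: "(\<integral>\<^sup>+x. ennreal (exp (- r * S m x)) \<partial>PiM {..<m} (\<lambda>_. M)) \<le> ennreal (\<rho> ^ m)" for m
  proof (induction m)
    case 0
    show ?case by (simp add: S_def P.prob_space prob_space.emeasure_space_1[OF prob_space_PiM])
  next
    case (Suc m)
    have ins: "{..<Suc m} = insert m {..<m}" by auto
    have "(\<integral>\<^sup>+x. ennreal (exp (- r * S (Suc m) x)) \<partial>PiM {..<Suc m} (\<lambda>_. M))
      = (\<integral>\<^sup>+x. \<integral>\<^sup>+c. ennreal (exp (- r * S (Suc m) (x(m := c)))) \<partial>M \<partial>PiM {..<m} (\<lambda>_. M))"
      unfolding ins by (rule P.product_nn_integral_insert) (auto simp flip: ins)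
    also have "\<dots> = (\<integral>\<^sup>+x. \<integral>\<^sup>+c. ennreal (exp (- r * S m x)) * ennreal (exp (- r * Z m x c)) \<partial>M \<partial>PiM {..<m} (\<lambda>_. M))"
    proof (intro nn_integral_cong)
      fix x c assume x: "x \<in> space (PiM {..<m} (\<lambda>_. M))"
      have "restrict (x(m := c)) {..<k} = restrict x {..<k}" if "k \<le> m" for k
        using that by (auto simp: restrict_def)
      moreover have "restrict x {..<m} = x" using x by (auto simp: space_PiM PiE_restrict)
      ultimately have "S (Suc m) (x(m := c)) = S m x + Z m x c" by (simp add: S_def)
      then show "ennreal (exp (- r * S (Suc m) (x(m := c)))) = ennreal (exp (- r * S m x)) * ennreal (exp (- r * Z m x c))"
        by (simp add: ennreal_mult[symmetric] exp_add[symmetric] algebra_simps)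
    qed
    also have "\<dots> = (\<integral>\<^sup>+x. ennreal (exp (- r * S m x)) * (\<integral>\<^sup>+c. ennreal (exp (- r * Z m x c)) \<partial>M) \<partial>PiM {..<m} (\<lambda>_. M))"
    proof (intro nn_integral_cong nn_integral_cmult)
      fix x assume x: "x \<in> space (PiM {..<m} (\<lambda>_. M))"
      have [measurable]: "Z m x \<in> borel_measurable M"
        using measurable_compose[OF measurable_Pair1'[OF x] meas[of m]] by simp
      show "(\<lambda>c. ennreal (exp (- r * Z m x c))) \<in> borel_measurable M" by measurable
    qed
    also have "\<dots> \<le> (\<integral>\<^sup>+x. ennreal (exp (- r * S m x)) * ennreal \<rho> \<partial>PiM {..<m} (\<lambda>_. M))"
      using inner by (intro nn_integral_mono mult_left_mono) auto
    also have "\<dots> = (\<integral>\<^sup>+x. ennreal (exp (- r * S m x)) \<partial>PiM {..<m} (\<lambda>_. M)) * ennreal \<rho>"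
      by (rule nn_integral_multc) measurable
    also have "\<dots> \<le> ennreal (\<rho> ^ m) * ennreal \<rho>" by (intro mult_right_mono Suc) auto
    also have "\<dots> = ennreal (\<rho> ^ Suc m)" by (simp add: ennreal_mult[symmetric] \<rho>_def mult_ac)
    finally show ?case .
  qed
  define T where "T = {x \<in> space (PiM {..<m} (\<lambda>_. M)). S m x \<le> m * (q - r)}"
  interpret Pm: prob_space "PiM {..<m} (\<lambda>_. M)" by (rule prob_space_PiM) unfold_locales
  have [measurable]: "T \<in> sets (PiM {..<m} (\<lambda>_. M))" unfolding T_def by measurable
  have "emeasure (PiM {..<m} (\<lambda>_. M)) T = (\<integral>\<^sup>+x. indicator T x \<partial>PiM {..<m} (\<lambda>_. M))" by simp
  \<comment> \<open>Exponential Markov inequality: the right-hand integrand is at least 1 on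
    \<open>T\<close>.\<close>
  also have "\<dots> \<le> (\<integral>\<^sup>+x. ennreal (exp (r * (m * (q - r)))) * ennreal (exp (- r * S m x)) \<partial>PiM {..<m} (\<lambda>_. M))"
  proof (intro nn_integral_mono)
    fix x
    show "indicator T x \<le> ennreal (exp (r * (m * (q - r)))) * ennreal (exp (- r * S m x))"
    proof (cases "x \<in> T")
      case True
      then have "r * S m x \<le> r * (m * (q - r))" using r by (intro mult_left_mono) (auto simp: T_def)
      then have "1 \<le> exp (r * (m * (q - r)) + - r * S m x)" by simp
      then show ?thesis using True by (simp add: ennreal_mult[symmetric] exp_add[symmetric])
    qed simp
  qed
  also have "\<dots> = ennreal (exp (r * (m * (q - r)))) * (\<integral>\<^sup>+x. ennreal (exp (- r * S m x)) \<partial>PiM {..<m} (\<lambda>_. M))"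
    by (rule nn_integral_cmult) measurable
  also have "\<dots> \<le> ennreal (exp (r * (m * (q - r)))) * ennreal (\<rho> ^ m)" by (intro mult_left_mono mgf) auto
  also have "\<dots> = ennreal (exp (- real m * r\<^sup>2 / 2))"
    unfolding \<rho>_def by (simp add: ennreal_mult[symmetric] exp_of_nat_mult[symmetric] exp_add[symmetric] field_simps power2_eq_square)
  finally show ?thesis
    unfolding Pm.emeasure_eq_measure T_def S_def by simp
qed

section \<open>Symmetric entry laws of unit variance and their characteristic function\<close>

locale symmetric_unit_law = prob_space \<mu> for \<mu> :: "real measure" +
  assumes sets_law[measurable_cong]: "sets \<mu> = sets borel"
    and integrable_square: "integrable \<mu> (\<lambda>x. x\<^sup>2)"
    and variance_one: "(\<integral>x. x\<^sup>2 \<partial>\<mu>) = 1"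
    and symmetric: "distr \<mu> borel uminus = \<mu>"
begin

abbreviation vec_law :: "nat \<Rightarrow> (nat \<Rightarrow> real) measure" where
  "vec_law n \<equiv> PiM {..<n} (\<lambda>_. \<mu>)"

text \<open>Used in both orientations for an N by n matrix: \<open>mat_law n N\<close> lists its
  columns, \<open>mat_law N n\<close> its rows.\<close>

abbreviation mat_law :: "nat \<Rightarrow> nat \<Rightarrow> (nat \<Rightarrow> nat \<Rightarrow> real) measure" where
  "mat_law m n \<equiv> PiM {..<m} (\<lambda>_. vec_law n)"

sublocale vec: product_prob_space "\<lambda>_::nat. \<mu>" by unfold_locales

lemma prob_space_vec_law: "prob_space (vec_law n)"
  by (rule prob_space_PiM) unfold_locales

lemma integral_component:
  fixes f :: "real \<Rightarrow> real"
  assumes "i < n" "f \<in> borel_measurable borel"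
  shows "(\<integral>x. f (x i) \<partial>vec_law n) = (\<integral>x. f x \<partial>\<mu>)"
proof -
  have "(\<integral>x. f x \<partial>\<mu>) = (\<integral>x. f x \<partial>distr (vec_law n) \<mu> (\<lambda>x. x i))"
    using assms by (subst distr_PiM_component) (auto intro: prob_space_axioms)
  also have "\<dots> = (\<integral>x. f (x i) \<partial>vec_law n)"
    using assms by (intro integral_distr) (auto simp: measurable_cong_sets[OF sets_law refl])
  finally show ?thesis ..
qed

lemma integrable_component:
  fixes f :: "real \<Rightarrow> real"
  assumes "i < n" "integrable \<mu> f"
  shows "integrable (vec_law n) (\<lambda>x. f (x i))"
proof (rule integrable_distr[where M' = \<mu> and T = "\<lambda>x. x i" and f = f])
  show "(\<lambda>x. x i) \<in> measurable (vec_law n) \<mu>" using assms(1) by (intro measurable_component_singleton) auto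
  show "integrable (distr (vec_law n) \<mu> (\<lambda>x. x i)) f"
    using assms by (subst distr_PiM_component) (auto intro: prob_space_axioms)
qed

text \<open>By symmetry this is the whole characteristic function: its imaginary part
  vanishes.\<close>

definition cos_mean :: "real \<Rightarrow> real" where "cos_mean s = (\<integral>x. cos (s * x) \<partial>\<mu>)"

lemma sin_mean: "(\<integral>x. sin (s * x) \<partial>\<mu>) = 0"
proof -
  have "(\<integral>x. sin (s * x) \<partial>\<mu>) = (\<integral>x. sin (s * x) \<partial>distr \<mu> borel uminus)" by (simp only: symmetric)
  also have "\<dots> = (\<integral>x. sin (s * - x) \<partial>\<mu>)" by (rule integral_distr) auto
  finally show ?thesis by simp
qed

text \<open>The addition formula splits off the last coordinate; the product of sines integrates to
  0 over that coordinate alone.\<close>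

lemma cos_sum_mean: "(\<integral>x. cos (\<Sum>j<n. s j * x j) \<partial>vec_law n) = (\<Prod>j<n. cos_mean (s j))"
proof (induction n)
  case 0
  show ?case using prob_space.prob_space[OF prob_space_vec_law[of 0]] by simp
next
  case (Suc n)
  interpret Pn: prob_space "vec_law n" by (rule prob_space_vec_law)
  interpret PS: prob_space "vec_law (Suc n)" by (rule prob_space_vec_law)
  have ins: "{..<Suc n} = insert n {..<n}" by auto
  have "(\<integral>x. cos (\<Sum>j<Suc n. s j * x j) \<partial>vec_law (Suc n))
      = (\<integral>x. \<integral>c. cos (\<Sum>j<Suc n. s j * (x(n := c)) j) \<partial>\<mu> \<partial>vec_law n)"
    unfolding ins
  proof (rule vec.product_integral_insert)
    show "integrable (PiM (insert n {..<n}) (\<lambda>_. \<mu>)) (\<lambda>x. cos (\<Sum>j\<in>insert n {..<n}. s j * x j))"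
      unfolding ins[symmetric] by (intro PS.integrable_const_bound[where B = 1]) (auto intro!: AE_I2)
  qed auto
  also have "\<dots> = (\<integral>x. cos (\<Sum>j<n. s j * x j) * cos_mean (s n) \<partial>vec_law n)"
  proof (intro Bochner_Integration.integral_cong refl)
    fix x
    have "(\<integral>c. cos (\<Sum>j<Suc n. s j * (x(n := c)) j) \<partial>\<mu>)
      = (\<integral>c. cos (\<Sum>j<n. s j * x j) * cos (s n * c) - sin (\<Sum>j<n. s j * x j) * sin (s n * c) \<partial>\<mu>)"
      by (simp add: cos_add)
    also have "\<dots> = (\<integral>c. cos (\<Sum>j<n. s j * x j) * cos (s n * c) \<partial>\<mu>) - (\<integral>c. sin (\<Sum>j<n. s j * x j) * sin (s n * c) \<partial>\<mu>)"
      by (intro Bochner_Integration.integral_diff integrable_mult_right integrable_const_bound[where B = 1]) (auto intro!: AE_I2)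
    finally show "(\<integral>c. cos (\<Sum>j<Suc n. s j * (x(n := c)) j) \<partial>\<mu>) = cos (\<Sum>j<n. s j * x j) * cos_mean (s n)"
      by (simp add: sin_mean cos_mean_def)
  qed
  also have "\<dots> = (\<Prod>j<Suc n. cos_mean (s j))" using Suc by simp
  finally show ?case .
qed

lemma truncated_second_moment:
  assumes "\<eta> > 0"
  shows "\<exists>T>0. (\<integral>x. x\<^sup>2 * indicator {-T..T} x \<partial>\<mu>) \<ge> 1 - \<eta>"
proof -
  have "(\<lambda>k. \<integral>x. x\<^sup>2 * indicator {-real k..real k} x \<partial>\<mu>) \<longlonglongrightarrow> (\<integral>x. x\<^sup>2 \<partial>\<mu>)"
  proof (rule integral_dominated_convergence[where w = "\<lambda>x. x\<^sup>2"])
    show "AE x in \<mu>. (\<lambda>k. x\<^sup>2 * indicator {-real k..real k} x) \<longlonglongrightarrow> x\<^sup>2"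
    proof (rule AE_I2)
      fix x :: real
      obtain k0 where k0: "\<bar>x\<bar> \<le> real k0" using real_arch_simple by blast
      have "\<forall>\<^sub>F k in sequentially. x\<^sup>2 * indicator {-real k..real k} x = x\<^sup>2"
        using eventually_ge_at_top[of k0]
        by eventually_elim (use k0 in \<open>auto simp: indicator_def abs_le_iff\<close>)
      then show "(\<lambda>k. x\<^sup>2 * indicator {-real k..real k} x) \<longlonglongrightarrow> x\<^sup>2" by (rule tendsto_eventually)
    qed
  qed (auto intro!: AE_I2 integrable_square simp: indicator_def)
  then have "\<forall>\<^sub>F k in sequentially. (\<integral>x. x\<^sup>2 * indicator {-real k..real k} x \<partial>\<mu>) > 1 - \<eta>"
    using assms by (intro order_tendstoD) (auto simp: variance_one)
  then obtain k where "(\<integral>x. x\<^sup>2 * indicator {-real k..real k} x \<partial>\<mu>) > 1 - \<eta>" "k > 0"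
    using eventually_happens[OF eventually_conj[OF _ eventually_gt_at_top[of 0]]] by fastforce
  then show ?thesis by (intro exI[of _ "real k"]) auto
qed

end

subsection \<open>Projections of a random vector\<close>

lemma cos_le_quartic: "cos x \<le> 1 - x\<^sup>2 / 2 + x ^ 4 / (24 :: real)"
proof -
  obtain t where "cos x = (\<Sum>m<4. cos_coeff m * x ^ m) + cos (t + 1 / 2 * real 4 * pi) / fact 4 * x ^ 4"
    using Maclaurin_cos_expansion[of x 4] by auto
  moreover have "(\<Sum>m<4. cos_coeff m * x ^ m) = 1 - x\<^sup>2 / 2"
  proof -
    have "{..<4} = {0, 1, 2, 3 :: nat}" by auto
    then show ?thesis by (simp add: cos_coeff_def)
  qed
  moreover have "cos (t + 1 / 2 * real 4 * pi) / fact 4 * x ^ 4 \<le> 1 / 24 * x ^ 4"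
    by (intro mult_right_mono) (auto simp: fact_numeral)
  ultimately show ?thesis by simp
qed

lemma cos_ge_quadratic: "1 - x\<^sup>2 / 2 \<le> cos (x :: real)"
proof -
  have "(sin (x / 2))\<^sup>2 \<le> (x / 2)\<^sup>2" by (metis abs_sin_x_le_abs_x abs_le_square_iff)
  moreover have "cos x = 1 - 2 * (sin (x / 2))\<^sup>2" using cos_double_sin[of "x / 2"] by simp
  ultimately show ?thesis by (simp add: power_divide)
qed

context symmetric_unit_law
begin

text \<open>The quartic Taylor bound is applied only where \<open>\<bar>x\<bar> \<le> T\<close>, so
  that x^4 is at most T^2 x^2 and the possibly infinite fourth moment never appears; outside, cos is
  at most 1. The window keeps all but \<open>\<eta> / 2\<close> of the second moment.\<close>

lemma cos_mean_bound:
  assumes \<eta>: "0 < \<eta>" "\<eta> < 1"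
  shows "\<exists>s\<^sub>0>0. \<forall>s. \<bar>s\<bar> \<le> s\<^sub>0 \<longrightarrow> \<bar>cos_mean s\<bar> \<le> exp (- (1 - \<eta>) * s\<^sup>2 / 2)"
proof -
  obtain T where T: "T > 0" "(\<integral>x. x\<^sup>2 * indicator {-T..T} x \<partial>\<mu>) \<ge> 1 - \<eta> / 2"
    using truncated_second_moment[of "\<eta> / 2"] \<eta> by auto
  define m where "m = (\<integral>x. x\<^sup>2 * indicator {-T..T} x \<partial>\<mu>)"
  have int_m: "integrable \<mu> (\<lambda>x. x\<^sup>2 * indicator {-T..T} x)"
    by (intro integrable_real_mult_indicator integrable_square) auto
  have int_cos: "integrable \<mu> (\<lambda>x. cos (s * x))" for s
    by (intro integrable_const_bound[where B = 1]) (auto intro!: AE_I2)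
  \<comment> \<open>The bound 1 makes \<open>cos_mean s\<close> nonnegative, which disposes of the
    absolute value. The other bound gives s^2 T^2 at most 6 \<eta>, so the quartic term takes only a
    fraction \<open>\<eta> / 2\<close> of the quadratic one.\<close>
  define s\<^sub>0 where "s\<^sub>0 = min 1 (sqrt (6 * \<eta>) / T)"
  have s0: "s\<^sub>0 > 0" using T \<eta> by (simp add: s\<^sub>0_def)
  have "\<bar>cos_mean s\<bar> \<le> exp (- (1 - \<eta>) * s\<^sup>2 / 2)" if s: "\<bar>s\<bar> \<le> s\<^sub>0" for s
  proof -
    have s1: "s\<^sup>2 \<le> 1" using s by (simp add: s\<^sub>0_def abs_square_le_1)
    have sT: "s\<^sup>2 * T\<^sup>2 \<le> 6 * \<eta>"
    proof -
      have "\<bar>s * T\<bar> \<le> sqrt (6 * \<eta>)" using s T by (simp add: s\<^sub>0_def abs_mult field_simps)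
      then have "(s * T)\<^sup>2 \<le> 6 * \<eta>" using \<eta> by (metis abs_ge_zero power2_abs power_mono real_sqrt_pow2 less_imp_le mult_nonneg_nonneg zero_le_numeral)
      then show ?thesis by (simp add: power_mult_distrib)
    qed
    have "cos_mean s \<ge> (\<integral>x. 1 - s\<^sup>2 / 2 * x\<^sup>2 \<partial>\<mu>)"
      unfolding cos_mean_def
      using cos_ge_quadratic[of "s * _"] integrable_square
      by (intro integral_mono int_cos) (auto simp: power_mult_distrib)
    also have "(\<integral>x. 1 - s\<^sup>2 / 2 * x\<^sup>2 \<partial>\<mu>) = 1 - s\<^sup>2 / 2"
      using integrable_square by (simp add: variance_one prob_space)
    finally have ge: "cos_mean s \<ge> 0" using s1 by simp
    have "cos_mean s \<le> (\<integral>x. 1 - (s\<^sup>2 / 2 - s ^ 4 * T\<^sup>2 / 24) * (x\<^sup>2 * indicator {-T..T} x) \<partial>\<mu>)"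
      unfolding cos_mean_def
    proof (intro integral_mono int_cos)
      show "integrable \<mu> (\<lambda>x. 1 - (s\<^sup>2 / 2 - s ^ 4 * T\<^sup>2 / 24) * (x\<^sup>2 * indicator {-T..T} x))"
        using int_m by simp
      fix x :: real
      show "cos (s * x) \<le> 1 - (s\<^sup>2 / 2 - s ^ 4 * T\<^sup>2 / 24) * (x\<^sup>2 * indicator {-T..T} x)"
      proof (cases "x \<in> {-T..T}")
        case True
        then have "x\<^sup>2 \<le> T\<^sup>2" by (simp add: abs_le_square_iff[symmetric] abs_le_iff)
        then have "s ^ 4 * x\<^sup>2 * x\<^sup>2 \<le> s ^ 4 * x\<^sup>2 * T\<^sup>2" by (intro mult_left_mono) auto
        then show ?thesis using True cos_le_quartic[of "s * x"]
          by (simp add: power_mult_distrib algebra_simps power2_eq_square power4_eq_xxxx)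
      qed simp
    qed
    also have "\<dots> = 1 - (s\<^sup>2 / 2 - s ^ 4 * T\<^sup>2 / 24) * m"
      using int_m by (simp add: m_def prob_space)
    also have "\<dots> \<le> 1 - (s\<^sup>2 / 2 * (1 - \<eta> / 2)) * (1 - \<eta> / 2)"
    proof -
      have "s ^ 4 * T\<^sup>2 \<le> s\<^sup>2 * (6 * \<eta>)"
        using mult_left_mono[OF sT, of "s\<^sup>2"] by (simp add: power2_eq_square power4_eq_xxxx mult_ac)
      moreover have "s\<^sup>2 / 2 * (1 - \<eta> / 2) = s\<^sup>2 / 2 - s\<^sup>2 * (6 * \<eta>) / 24" by (simp add: field_simps)
      ultimately have "s\<^sup>2 / 2 * (1 - \<eta> / 2) \<le> s\<^sup>2 / 2 - s ^ 4 * T\<^sup>2 / 24" by linarith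
      then have "(s\<^sup>2 / 2 * (1 - \<eta> / 2)) * (1 - \<eta> / 2) \<le> (s\<^sup>2 / 2 - s ^ 4 * T\<^sup>2 / 24) * m"
        using T \<eta> unfolding m_def by (intro mult_mono') auto
      then show ?thesis by simp
    qed
    also have "\<dots> \<le> 1 + - (1 - \<eta>) * s\<^sup>2 / 2"
    proof -
      have "1 - \<eta> \<le> (1 - \<eta> / 2) * (1 - \<eta> / 2)" by (simp add: algebra_simps)
      then have "(1 - \<eta>) * (s\<^sup>2 / 2) \<le> (1 - \<eta> / 2) * (1 - \<eta> / 2) * (s\<^sup>2 / 2)" by (rule mult_right_mono) simp
      moreover have "(s\<^sup>2 / 2 * (1 - \<eta> / 2)) * (1 - \<eta> / 2) = (1 - \<eta> / 2) * (1 - \<eta> / 2) * (s\<^sup>2 / 2)"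
        "- (1 - \<eta>) * s\<^sup>2 / 2 = - ((1 - \<eta>) * (s\<^sup>2 / 2))" by (simp_all add: field_simps)
      ultimately show ?thesis by linarith
    qed
    also have "\<dots> \<le> exp (- (1 - \<eta>) * s\<^sup>2 / 2)" by (rule exp_ge_add_one_self)
    finally show ?thesis using ge by simp
  qed
  with s0 show ?thesis by blast
qed

text \<open>
  The bounded quantity \<open>1 - cos (s * t)\<close> stands in for \<open>(s * t)\<^sup>2 / 2\<close>, which it
  minorises; its mean factorises over independent symmetric coordinates.
\<close>

lemma one_minus_cos_mean:
  assumes \<eta>: "0 < \<eta>" "\<eta> < 1"
  shows "\<exists>s>0. s \<le> 1 \<and> (\<forall>n y. (\<Sum>j<n. (y j)\<^sup>2) = 1 \<longrightarrow>
    (1 - 2 * \<eta>) * s\<^sup>2 / 2 \<le> (\<integral>x. 1 - cos (s * (\<Sum>j<n. y j * x j)) \<partial>vec_law n))"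
proof -
  obtain s\<^sub>0 where s0: "s\<^sub>0 > 0" "\<And>s. \<bar>s\<bar> \<le> s\<^sub>0 \<Longrightarrow> \<bar>cos_mean s\<bar> \<le> exp (- (1 - \<eta>) * s\<^sup>2 / 2)"
    using cos_mean_bound[OF \<eta>] by blast
  \<comment> \<open>Coordinates of a unit vector are at most 1, so every \<open>s * y j\<close>
    stays in the range of \<open>cos_mean_bound\<close>; \<open>s \<le> sqrt \<eta>\<close> lets the
    second \<open>\<eta>\<close> absorb the quadratic error of the exponential.\<close>
  define s where "s = min s\<^sub>0 (min 1 (sqrt \<eta>))"
  have s: "s > 0" "s \<le> s\<^sub>0" "s \<le> 1" using s0(1) \<eta> unfolding s_def
    by (auto intro: min.coboundedI1 min.coboundedI2)
  have s2: "s\<^sup>2 \<le> \<eta>"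
  proof -
    have "s \<le> sqrt \<eta>" by (simp add: s_def)
    then show ?thesis using s \<eta> by (metis less_imp_le power_mono real_sqrt_pow2)
  qed
  have "(1 - 2 * \<eta>) * s\<^sup>2 / 2 \<le> (\<integral>x. 1 - cos (s * (\<Sum>j<n. y j * x j)) \<partial>vec_law n)"
    if y: "(\<Sum>j<n. (y j)\<^sup>2) = 1" for n y
  proof -
    interpret Pn: prob_space "vec_law n" by (rule prob_space_vec_law)
    have y1: "\<bar>y j\<bar> \<le> 1" if "j < n" for j
    proof -
      have "(y j)\<^sup>2 \<le> (\<Sum>j<n. (y j)\<^sup>2)" using that by (intro member_le_sum) auto
      then show ?thesis using y by (simp add: abs_square_le_1)
    qed
    have "(\<integral>x. cos (s * (\<Sum>j<n. y j * x j)) \<partial>vec_law n) = (\<Prod>j<n. cos_mean (s * y j))"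
      using cos_sum_mean[of n "\<lambda>j. s * y j"] by (simp add: sum_distrib_left mult_ac)
    also have "\<dots> \<le> \<bar>\<Prod>j<n. cos_mean (s * y j)\<bar>" by simp
    also have "\<dots> = (\<Prod>j<n. \<bar>cos_mean (s * y j)\<bar>)" by (simp add: abs_prod)
    also have "\<dots> \<le> (\<Prod>j<n. exp (- (1 - \<eta>) * (s * y j)\<^sup>2 / 2))"
    proof (intro prod_mono conjI s0)
      fix j assume "j \<in> {..<n}"
      then have "s * \<bar>y j\<bar> \<le> s * 1" using y1 s by (intro mult_left_mono) auto
      then show "\<bar>s * y j\<bar> \<le> s\<^sub>0" using s by (simp only: abs_mult)
    qed auto
    also have "\<dots> = exp (- (1 - \<eta>) * s\<^sup>2 / 2)"
      by (subst exp_sum[symmetric]) (auto simp: power_mult_distrib y simp flip: sum_distrib_left sum_divide_distrib)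
    also have "\<dots> \<le> 1 - (1 - \<eta>) * s\<^sup>2 / 2 + ((1 - \<eta>) * s\<^sup>2 / 2)\<^sup>2 / 2"
    proof -
      have "0 \<le> (1 - \<eta>) * s\<^sup>2 / 2" using \<eta> by simp
      from exp_minus_le_quadratic[OF this] show ?thesis by (simp only: minus_divide_left mult_minus_left)
    qed
    also have "\<dots> \<le> 1 - (1 - 2 * \<eta>) * s\<^sup>2 / 2"
    proof -
      have "((1 - \<eta>) * s\<^sup>2 / 2)\<^sup>2 \<le> (s\<^sup>2 / 2)\<^sup>2"
        using \<eta> by (intro power_mono divide_right_mono mult_left_le_one_le) auto
      also have "\<dots> = s\<^sup>2 * s\<^sup>2 / 4" by (simp add: power2_eq_square)
      also have "\<dots> \<le> s\<^sup>2 * \<eta> / 4" using s2 by (intro divide_right_mono mult_left_mono) auto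
      also have "\<dots> \<le> \<eta> * s\<^sup>2" using \<eta> by simp
      finally have "((1 - \<eta>) * s\<^sup>2 / 2)\<^sup>2 / 2 \<le> \<eta> * s\<^sup>2 / 2" by simp
      moreover have "(1 - 2 * \<eta>) * s\<^sup>2 / 2 = (1 - \<eta>) * s\<^sup>2 / 2 - \<eta> * s\<^sup>2 / 2" by (simp add: field_simps)
      ultimately show ?thesis by linarith
    qed
    finally have "(\<integral>x. cos (s * (\<Sum>j<n. y j * x j)) \<partial>vec_law n) \<le> 1 - (1 - 2 * \<eta>) * s\<^sup>2 / 2" .
    moreover have "(\<integral>x. 1 - cos (s * (\<Sum>j<n. y j * x j)) \<partial>vec_law n)
      = 1 - (\<integral>x. cos (s * (\<Sum>j<n. y j * x j)) \<partial>vec_law n)"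
      by (subst Bochner_Integration.integral_diff)
         (auto intro!: Pn.integrable_const_bound[where B = 1] AE_I2 simp: Pn.prob_space)
    ultimately show ?thesis by simp
  qed
  with s show ?thesis by blast
qed

text \<open>The variable 1 - cos is at most 2 everywhere and at most s^2 / 8 where the projection is
  small, while its mean is at least s^2 / 4. Hence the projection is large with probability at least
  s^2 / 16, whatever \<open>n\<close> and \<open>y\<close> are.\<close>

lemma small_ball:
  "\<exists>q>0. q \<le> 1 \<and> (\<forall>n y. q \<le> measure (vec_law n)
    {x \<in> space (vec_law n). sqrt (\<Sum>j<n. (y j)\<^sup>2) / 2 \<le> \<bar>\<Sum>j<n. y j * x j\<bar>})"
proof -
  obtain s where s: "s > 0" "s \<le> 1" and mean: "\<And>n y. (\<Sum>j<n. (y j)\<^sup>2) = 1 \<Longrightarrow>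
      (1 - 2 * (1 / 4)) * s\<^sup>2 / 2 \<le> (\<integral>x. 1 - cos (s * (\<Sum>j<n. y j * x j)) \<partial>vec_law n)"
    using one_minus_cos_mean[of "1 / 4"] by auto
  have s1: "s\<^sup>2 \<le> 1" using s by (simp add: power_le_one)
  have "s\<^sup>2 / 16 \<le> measure (vec_law n)
    {x \<in> space (vec_law n). sqrt (\<Sum>j<n. (y j)\<^sup>2) / 2 \<le> \<bar>\<Sum>j<n. y j * x j\<bar>}" for n y
  proof (cases "(\<Sum>j<n. (y j)\<^sup>2) = 0")
    case True
    interpret Pn: prob_space "vec_law n" by (rule prob_space_vec_law)
    show ?thesis using True s1 by (simp add: Pn.prob_space)
  next
    case False
    interpret Pn: prob_space "vec_law n" by (rule prob_space_vec_law)
    define r where "r = sqrt (\<Sum>j<n. (y j)\<^sup>2)"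
    have "(\<Sum>j<n. (y j)\<^sup>2) > 0" using False sum_nonneg[of "{..<n}" "\<lambda>j. (y j)\<^sup>2"] by force
    then have r: "r > 0" "r\<^sup>2 = (\<Sum>j<n. (y j)\<^sup>2)" by (auto simp: r_def)
    define A where "A = {x \<in> space (vec_law n). r / 2 \<le> \<bar>\<Sum>j<n. y j * x j\<bar>}"
    have [measurable]: "A \<in> sets (vec_law n)" unfolding A_def by measurable
    have "(\<Sum>j<n. (y j / r)\<^sup>2) = 1"
      using r False by (simp add: power_divide flip: sum_divide_distrib)
    from mean[OF this] have "s\<^sup>2 / 4 \<le> (\<integral>x. 1 - cos (s * (\<Sum>j<n. y j / r * x j)) \<partial>vec_law n)" by simp
    also have "\<dots> \<le> (\<integral>x. 2 * indicator A x + s\<^sup>2 / 8 \<partial>vec_law n)"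
    proof (rule integral_mono)
      show "integrable (vec_law n) (\<lambda>x. 1 - cos (s * (\<Sum>j<n. y j / r * x j)))"
        by (intro Bochner_Integration.integrable_diff Pn.integrable_const_bound[where B = 1]) (auto intro!: AE_I2)
      show "integrable (vec_law n) (\<lambda>x. 2 * indicator A x + s\<^sup>2 / 8)"
        by (intro Bochner_Integration.integrable_add integrable_mult_right) (auto simp: Pn.emeasure_eq_measure)
      fix x assume x: "x \<in> space (vec_law n)"
      have eq: "(\<Sum>j<n. y j / r * x j) = (\<Sum>j<n. y j * x j) / r" by (simp add: sum_divide_distrib)
      show "1 - cos (s * (\<Sum>j<n. y j / r * x j)) \<le> 2 * indicator A x + s\<^sup>2 / 8"
      proof (cases "x \<in> A")
        case True
        have "1 - cos (s * (\<Sum>j<n. y j / r * x j)) \<le> 2" using cos_ge_minus_one[of "s * (\<Sum>j<n. y j / r * x j)"] by linarith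
        then show ?thesis using True by (simp add: add_increasing2)
      next
        case nA: False
        then have "\<bar>(\<Sum>j<n. y j * x j) / r\<bar> \<le> 1 / 2" using x r by (simp add: A_def field_simps)
        then have "((\<Sum>j<n. y j * x j) / r)\<^sup>2 \<le> (1 / 2)\<^sup>2" by (metis abs_ge_zero power2_abs power_mono)
        then have "s\<^sup>2 * ((\<Sum>j<n. y j * x j) / r)\<^sup>2 \<le> s\<^sup>2 * (1 / 4)"
          by (intro mult_left_mono) (auto simp: power2_eq_square)
        then have "1 - cos (s * (\<Sum>j<n. y j / r * x j)) \<le> s\<^sup>2 / 8"
          using cos_ge_quadratic[of "s * ((\<Sum>j<n. y j * x j) / r)"] unfolding eq power_mult_distrib by linarith
        then show ?thesis using nA by simp
      qed
    qed
    also have "\<dots> = 2 * measure (vec_law n) A + s\<^sup>2 / 8"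
      by (subst Bochner_Integration.integral_add) (auto simp: Pn.emeasure_eq_measure Pn.prob_space)
    finally show ?thesis unfolding A_def r_def by simp
  qed
  then show ?thesis using s s1 by (intro exI[of _ "s\<^sup>2 / 16"]) auto
qed

text \<open>Truncation at T splits the squares: the bounded part concentrates, the rest has tiny
  mean and falls to Markov. Only a small constant probability \<open>p\<close> results, so a fixed
  fraction of columns may exceed the norm cap; hence the skipping in
  \<open>greedy_sign\<close>.\<close>

lemma square_norm_upper_tail:
  fixes \<eta> p :: real
  assumes \<eta>: "\<eta> > 0" and p: "p > 0"
  shows "\<exists>N\<^sub>0. \<forall>N\<ge>N\<^sub>0. measure (vec_law N)
    {x \<in> space (vec_law N). (\<Sum>i<N. (x i)\<^sup>2) > (1 + \<eta>) * N} \<le> p"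
proof -
  \<comment> \<open>With tail mean \<open>\<eta> * p / 4\<close> per coordinate, Markov at level
    \<open>\<eta> * N / 2\<close> gives \<open>p / 2\<close>.\<close>
  obtain T where T: "T > 0" "(\<integral>x. x\<^sup>2 * indicator {-T..T} x \<partial>\<mu>) \<ge> 1 - \<eta> * p / 4"
    using truncated_second_moment[of "\<eta> * p / 4"] \<eta> p by auto
  define f where "f x = x\<^sup>2 * indicator {-T..T} x" for x :: real
  define g where "g x = x\<^sup>2 * indicator (- {-T..T}) x" for x :: real
  have fg: "x\<^sup>2 = f x + g x" for x by (simp add: f_def g_def indicator_def)
  have [measurable]: "f \<in> borel_measurable borel" "g \<in> borel_measurable borel"
    unfolding f_def[abs_def] g_def[abs_def] by measurable
  have int: "integrable \<mu> f" "integrable \<mu> g"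
    unfolding f_def[abs_def] g_def[abs_def]
    by (intro integrable_real_mult_indicator integrable_square; simp)+
  have Ef: "(\<integral>x. f x \<partial>\<mu>) + (\<integral>x. g x \<partial>\<mu>) = 1"
    using int variance_one by (simp add: fg flip: Bochner_Integration.integral_add)
  have Eg: "(\<integral>x. g x \<partial>\<mu>) \<le> \<eta> * p / 4" using Ef T by (simp add: f_def)
  have f0: "0 \<le> f x" and g0: "0 \<le> g x" for x by (auto simp: f_def g_def)
  have fT: "f x \<le> T\<^sup>2" for x using T by (auto simp: f_def indicator_def abs_le_square_iff[symmetric])
  have Ef1: "(\<integral>x. f x \<partial>\<mu>) \<le> 1"
  proof -
    have "0 \<le> (\<integral>x. g x \<partial>\<mu>)" using g0 by (intro integral_nonneg_AE) auto
    then show ?thesis using Ef by simp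
  qed
  \<comment> \<open>A deviation \<open>r\<close> of the rescaled variable
    \<open>f / T\<^sup>2\<close> is a deviation \<open>\<eta> / 2\<close> of \<open>f\<close>.
    Passing to \<open>1 - f / T\<^sup>2\<close> turns the upper tail of \<open>f\<close> into a
    lower tail.\<close>
  define r where "r = \<eta> / (2 * T\<^sup>2)"
  have r: "r > 0" using \<eta> T by (simp add: r_def)
  have T2: "T\<^sup>2 > 0" using T by simp
  have "((\<lambda>N. exp (- real N * r\<^sup>2 / 2)) \<longlongrightarrow> 0) sequentially"
    using r by real_asymp
  then have "\<forall>\<^sub>F N in sequentially. exp (- real N * r\<^sup>2 / 2) < p / 2"
    using p by (intro order_tendstoD) auto
  then obtain N\<^sub>0 where N0: "\<And>N. N \<ge> N\<^sub>0 \<Longrightarrow> exp (- real N * r\<^sup>2 / 2) < p / 2"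
    by (auto simp: eventually_sequentially)
  have "measure (vec_law N) {x \<in> space (vec_law N). (\<Sum>i<N. (x i)\<^sup>2) > (1 + \<eta>) * N} \<le> p"
    if N: "N \<ge> max 1 N\<^sub>0" for N
  proof -
    interpret PN: prob_space "vec_law N" by (rule prob_space_vec_law)
    define A where "A = {x \<in> space (vec_law N). (\<Sum>i<N. 1 - f (x i) / T\<^sup>2) \<le> N * ((1 - 1 / T\<^sup>2) - r)}"
    define B where "B = {x \<in> space (vec_law N). (\<Sum>i<N. g (x i)) \<ge> \<eta> * N / 2}"
    have [measurable]: "A \<in> sets (vec_law N)" "B \<in> sets (vec_law N)"
      unfolding A_def B_def by measurable
    have "measure (vec_law N) A \<le> exp (- real N * r\<^sup>2 / 2)"
      unfolding A_def
    proof (rule adapted_lower_tail[where Z = "\<lambda>_ _ c. 1 - f c / T\<^sup>2"])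
      fix k :: nat and x
      have "(\<integral>c. 1 - f c / T\<^sup>2 \<partial>\<mu>) = 1 - (\<integral>c. f c \<partial>\<mu>) / T\<^sup>2" using int by (simp add: prob_space)
      moreover have "(\<integral>c. f c \<partial>\<mu>) / T\<^sup>2 \<le> 1 / T\<^sup>2" using Ef1 by (intro divide_right_mono) auto
      ultimately show "1 - 1 / T\<^sup>2 \<le> (\<integral>c. 1 - f c / T\<^sup>2 \<partial>\<mu>)" by simp
    qed (use f0 fT T2 r in \<open>auto simp: field_simps\<close>)
    then have A: "measure (vec_law N) A \<le> p / 2" using N0[of N] N by simp
    have int': "integrable (vec_law N) (\<lambda>x. \<Sum>i<N. g (x i))"
      by (intro Bochner_Integration.integrable_sum integrable_component int) auto
    have EB: "(\<integral>x. (\<Sum>i<N. g (x i)) \<partial>vec_law N) = N * (\<integral>x. g x \<partial>\<mu>)"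
      using int by (subst Bochner_Integration.integral_sum) (auto simp: integral_component intro!: integrable_component)
    have "measure (vec_law N) B \<le> (\<integral>x. (\<Sum>i<N. g (x i)) \<partial>vec_law N) / (\<eta> * N / 2)"
      unfolding B_def using int' N \<eta> g0
      by (intro integral_Markov_inequality_measure[where A = "space (vec_law N)" for A])
         (auto intro!: sum_nonneg)
    also have "\<dots> \<le> p / 2" unfolding EB using Eg N \<eta> by (simp add: field_simps)
    finally have B: "measure (vec_law N) B \<le> p / 2" .
    have "measure (vec_law N) {x \<in> space (vec_law N). (\<Sum>i<N. (x i)\<^sup>2) > (1 + \<eta>) * N} \<le> measure (vec_law N) (A \<union> B)"
    proof (intro PN.finite_measure_mono subsetI)
      fix x assume x: "x \<in> {x \<in> space (vec_law N). (\<Sum>i<N. (x i)\<^sup>2) > (1 + \<eta>) * N}"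
      show "x \<in> A \<union> B"
      proof (rule ccontr)
        assume nAB: "x \<notin> A \<union> B"
        then have "N * ((1 - 1 / T\<^sup>2) - r) < (\<Sum>i<N. 1 - f (x i) / T\<^sup>2)" using x by (auto simp: A_def)
        also have "\<dots> = N - (\<Sum>i<N. f (x i)) / T\<^sup>2" by (simp add: sum_subtractf sum_divide_distrib)
        finally have "(\<Sum>i<N. f (x i)) / T\<^sup>2 < N * (1 / T\<^sup>2 + r)" by (simp add: algebra_simps)
        then have "(\<Sum>i<N. f (x i)) < N * (1 + \<eta> / 2)" using T2 by (simp add: r_def field_simps)
        moreover have "(\<Sum>i<N. g (x i)) < \<eta> * N / 2" using nAB x by (auto simp: B_def)
        ultimately have "(\<Sum>i<N. (x i)\<^sup>2) < (1 + \<eta>) * N" by (simp add: fg sum.distrib algebra_simps)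
        then show False using x by simp
      qed
    qed auto
    also have "\<dots> \<le> p" using measure_Un_le[of A "vec_law N" B] A B by simp
    finally show ?thesis .
  qed
  then show ?thesis by blast
qed

end

subsection \<open>The greedy test vector\<close>

context symmetric_unit_law
begin

lemma greedy_sum_measurable:
  assumes "m \<le> k" "i < N"
  shows "(\<lambda>x. greedy_sum N B x m i) \<in> borel_measurable (mat_law k N)"
  using assms
proof (induction m arbitrary: i)
  case (Suc m)
  have x[measurable]: "(\<lambda>x. x m i) \<in> borel_measurable (mat_law k N)" if "i < N" for i
  proof -
    have "(\<lambda>x. x m) \<in> measurable (mat_law k N) (vec_law N)"
      using Suc.prems by (intro measurable_component_singleton) auto
    moreover have "(\<lambda>c. c i) \<in> borel_measurable (vec_law N)"
      using that measurable_component_singleton[of i "{..<N}" "\<lambda>_. \<mu>"] by simp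
    ultimately show ?thesis by (rule measurable_compose)
  qed
  have y[measurable]: "(\<lambda>x. greedy_sum N B x m i) \<in> borel_measurable (mat_law k N)"
    if "i < N" for i using that Suc by simp
  have [measurable]: "(\<lambda>x. \<Sum>i<N. (x m i)\<^sup>2) \<in> borel_measurable (mat_law k N)"
    "(\<lambda>x. \<Sum>i<N. greedy_sum N B x m i * x m i) \<in> borel_measurable (mat_law k N)"
    by (auto intro!: borel_measurable_sum borel_measurable_power borel_measurable_times x y)
  show ?case
    using x[OF Suc.prems(2)] y[OF Suc.prems(2)] unfolding greedy_sum.simps greedy_sign_def
    by measurable
qed simp

text \<open>Given the earlier columns, the next one is a hit with probability at least
  \<open>q / 2\<close>, and \<open>adapted_lower_tail\<close> with deviation \<open>q / 4\<close>
  counts the hits. Fixing \<open>q\<close> before \<open>\<eta>\<close> matters: the norm cap is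
  later chosen in terms of \<open>q\<close>.\<close>

lemma greedy_hits_lower_tail:
  "\<exists>q>0. q \<le> 1 \<and> (\<forall>\<eta>::real. \<eta> > 0 \<longrightarrow> (\<exists>N\<^sub>0. \<forall>N\<ge>N\<^sub>0. \<forall>n.
    \<exists>E\<in>sets (mat_law n N).
      measure (mat_law n N) E \<le> exp (- real n * (q / 4)\<^sup>2 / 2) \<and>
      (\<forall>x\<in>space (mat_law n N) - E. real n * (q / 4) < real (card {l\<in>{..<n}.
        greedy_hit N ((1 + \<eta>) * N) (greedy_sum N ((1 + \<eta>) * N) x l) (x l)}))))"
proof -
  obtain q where q: "q > 0" "q \<le> 1" and ball: "\<And>n y. q \<le> measure (vec_law n)
    {x \<in> space (vec_law n). sqrt (\<Sum>j<n. (y j)\<^sup>2) / 2 \<le> \<bar>\<Sum>j<n. y j * x j\<bar>}"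
    using small_ball by blast
  have "\<exists>N\<^sub>0. \<forall>N\<ge>N\<^sub>0. \<forall>n. \<exists>E\<in>sets (mat_law n N).
      measure (mat_law n N) E \<le> exp (- real n * (q / 4)\<^sup>2 / 2) \<and>
      (\<forall>x\<in>space (mat_law n N) - E. real n * (q / 4) < real (card {l\<in>{..<n}.
        greedy_hit N ((1 + \<eta>) * N) (greedy_sum N ((1 + \<eta>) * N) x l) (x l)}))"
    if \<eta>: "\<eta> > 0" for \<eta> :: real
  proof -
    obtain N\<^sub>0 where N0: "\<And>N. N \<ge> N\<^sub>0 \<Longrightarrow> measure (vec_law N)
        {x \<in> space (vec_law N). (\<Sum>i<N. (x i)\<^sup>2) > (1 + \<eta>) * N} \<le> q / 2"
      using square_norm_upper_tail[OF \<eta>, of "q / 2"] q by auto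
    have "\<exists>E\<in>sets (mat_law n N).
      measure (mat_law n N) E \<le> exp (- real n * (q / 4)\<^sup>2 / 2) \<and>
      (\<forall>x\<in>space (mat_law n N) - E. real n * (q / 4) < real (card {l\<in>{..<n}.
        greedy_hit N ((1 + \<eta>) * N) (greedy_sum N ((1 + \<eta>) * N) x l) (x l)}))"
      if N: "N \<ge> N\<^sub>0" for N n
    proof -
      interpret PN: prob_space "vec_law N" by (rule prob_space_vec_law)
      define B where "B = (1 + \<eta>) * N"
      define Z where "Z k x c = (if greedy_hit N B (greedy_sum N B x k) c then 1 else 0 :: real)" for k x c
      have meas: "(\<lambda>(x, c). Z k x c) \<in> borel_measurable (mat_law k N \<Otimes>\<^sub>M vec_law N)" for k
      proof -
        have y: "(\<lambda>z. greedy_sum N B (fst z) k i) \<in> borel_measurable (mat_law k N \<Otimes>\<^sub>M vec_law N)"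
          if "i < N" for i
          using measurable_compose[OF measurable_fst greedy_sum_measurable[OF order_refl that]] .
        have c: "(\<lambda>z. snd z i) \<in> borel_measurable (mat_law k N \<Otimes>\<^sub>M vec_law N)"
          if "i < N" for i
        proof -
          have "(\<lambda>c. c i) \<in> borel_measurable (vec_law N)"
      using that measurable_component_singleton[of i "{..<N}" "\<lambda>_. \<mu>"] by simp
          then show ?thesis by (rule measurable_compose[OF measurable_snd])
        qed
        have [measurable]:
          "(\<lambda>z. \<Sum>i<N. (snd z i)\<^sup>2) \<in> borel_measurable (mat_law k N \<Otimes>\<^sub>M vec_law N)"
          "(\<lambda>z. \<Sum>i<N. (greedy_sum N B (fst z) k i)\<^sup>2) \<in> borel_measurable (mat_law k N \<Otimes>\<^sub>M vec_law N)"
          "(\<lambda>z. \<Sum>i<N. greedy_sum N B (fst z) k i * snd z i) \<in> borel_measurable (mat_law k N \<Otimes>\<^sub>M vec_law N)"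
          by (auto intro!: borel_measurable_sum borel_measurable_power borel_measurable_times y c)
        show ?thesis unfolding Z_def greedy_hit_def case_prod_beta' by measurable
      qed
      \<comment> \<open>The small-ball probability \<open>q\<close> loses at most
        \<open>q / 2\<close> to columns above the norm cap.\<close>
      have mean: "q / 2 \<le> (\<integral>c. Z k x c \<partial>vec_law N)" for k x
      proof -
        define y where "y = greedy_sum N B x k"
        define G where "G = {c \<in> space (vec_law N). sqrt (\<Sum>j<N. (y j)\<^sup>2) / 2 \<le> \<bar>\<Sum>j<N. y j * c j\<bar>}"
        define H where "H = {c \<in> space (vec_law N). (\<Sum>i<N. (c i)\<^sup>2) > B}"
        have [measurable]: "G \<in> sets (vec_law N)" "H \<in> sets (vec_law N)"
          unfolding G_def H_def by measurable
        have "q \<le> measure (vec_law N) G" unfolding G_def by (rule ball)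
        then have "q / 2 \<le> measure (vec_law N) G - measure (vec_law N) H"
          using N0[OF N] by (simp add: H_def B_def)
        also have "\<dots> \<le> measure (vec_law N) (G - H)"
          using measure_Un_le[of "G - H" "vec_law N" H] PN.finite_measure_mono[of G "(G - H) \<union> H"] by auto
        also have "\<dots> = (\<integral>c. indicator (G - H) c \<partial>vec_law N)" by simp
        also have "\<dots> = (\<integral>c. Z k x c \<partial>vec_law N)"
          by (intro Bochner_Integration.integral_cong) (auto simp: Z_def G_def H_def y_def greedy_hit_def indicator_def)
        finally show ?thesis .
      qed
      define E where "E = {x \<in> space (mat_law n N).
        (\<Sum>k<n. Z k (restrict x {..<k}) (x k)) \<le> n * (q / 2 - q / 4)}"
      have mE: "measure (mat_law n N) E \<le> exp (- real n * (q / 4)\<^sup>2 / 2)"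
        unfolding E_def using meas mean q by (intro PN.adapted_lower_tail) (auto simp: Z_def)
      have cnt: "(\<Sum>k<n. Z k (restrict x {..<k}) (x k)) = real (card {l\<in>{..<n}.
        greedy_hit N B (greedy_sum N B x l) (x l)})" for x
      proof -
        have "Z k (restrict x {..<k}) (x k) = of_bool (greedy_hit N B (greedy_sum N B x k) (x k))" for k
          unfolding Z_def using greedy_sum_cong[of k "restrict x {..<k}" x N B] by simp
        then show ?thesis by (simp add: Int_def conj_commute)
      qed
      have sE: "E \<in> sets (mat_law n N)"
      proof -
        have "(\<lambda>x. Z k (restrict x {..<k}) (x k)) \<in> borel_measurable (mat_law n N)" if "k < n" for k
        proof -
          have "(\<lambda>x. (restrict x {..<k}, x k)) \<in> measurable (mat_law n N) (mat_law k N \<Otimes>\<^sub>M vec_law N)"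
            using that by (intro measurable_Pair measurable_restrict_subset measurable_component_singleton) auto
          from measurable_compose[OF this meas] show ?thesis by simp
        qed
        then have [measurable]: "(\<lambda>x. \<Sum>k<n. Z k (restrict x {..<k}) (x k)) \<in> borel_measurable (mat_law n N)"
          by (intro borel_measurable_sum) auto
        show ?thesis unfolding E_def by measurable
      qed
      have "real n * (q / 4) < real (card {l\<in>{..<n}. greedy_hit N B (greedy_sum N B x l) (x l)})"
        if "x \<in> space (mat_law n N) - E" for x
        using that unfolding E_def cnt by (auto simp: not_le)
      with mE sE show ?thesis unfolding B_def[symmetric] by blast
    qed
    then show ?thesis by blast
  qed
  with q show ?thesis by blast
qed

text \<open>Here \<open>s\<close> is any lower bound for the singular values. Combining the two
  bounds for the squared length of the greedy sum gives gain at most m (B - s^2), with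
  \<open>m \<le> n\<close> columns used, gain of order n^2 and \<open>B\<close> close to a n; so s^2
  lies below a n by order n.\<close>

lemma smallest_value_upper_bound:
  fixes a :: real
  assumes a: "a > 1"
  shows "\<exists>c\<^sub>1>0. c\<^sub>1 \<le> a \<and> (\<exists>c>0. \<exists>n\<^sub>0. \<forall>n\<ge>n\<^sub>0. \<forall>N. N = nat \<lceil>a * real n\<rceil> \<longrightarrow>
    (\<exists>E\<in>sets (mat_law n N).
      measure (mat_law n N) E \<le> exp (- c * n) \<and>
      (\<forall>x\<in>space (mat_law n N) - E. \<forall>s\<ge>0.
        (\<forall>w. s\<^sup>2 * (\<Sum>l<n. (w l)\<^sup>2) \<le> (\<Sum>i<N. (\<Sum>l<n. w l * x l i)\<^sup>2)) \<longrightarrow> s\<^sup>2 \<le> (a - c\<^sub>1) * n)))"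
proof -
  obtain q where q: "q > 0" "q \<le> 1" and hits: "\<And>\<eta>::real. \<eta> > 0 \<Longrightarrow> \<exists>N\<^sub>0. \<forall>N\<ge>N\<^sub>0. \<forall>n.
    \<exists>E\<in>sets (mat_law n N).
      measure (mat_law n N) E \<le> exp (- real n * (q / 4)\<^sup>2 / 2) \<and>
      (\<forall>x\<in>space (mat_law n N) - E. real n * (q / 4) < real (card {l\<in>{..<n}.
        greedy_hit N ((1 + \<eta>) * N) (greedy_sum N ((1 + \<eta>) * N) x l) (x l)}))"
    using greedy_hits_lower_tail by blast
  \<comment> \<open>With \<open>s \<ge> sqrt n\<close>, \<open>t \<ge> n * (q / 16)\<close> and
    \<open>e - t \<ge> n * (q / 8)\<close>, the gain is at least g n^2.\<close>
  define g where "g = sqrt (q / 16) * (q / 8)"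
  have g: "g > 0" using q by (simp add: g_def)
  \<comment> \<open>The slack in the norm cap then costs at most g n / 4.\<close>
  define \<eta> where "\<eta> = min 1 (g / (4 * a))"
  have \<eta>: "\<eta> > 0" "\<eta> \<le> 1" "\<eta> * a \<le> g / 4"
    using g a by (auto simp: \<eta>_def min_def field_simps)
  \<comment> \<open>Half of \<open>g\<close> survives the slack and the rounding of
    \<open>N\<close>. The bound \<open>a - 1\<close> ensures that
    \<open>s\<^sup>2 > (a - c\<^sub>1) * n\<close> forces \<open>s \<ge> sqrt n\<close>, where
    \<open>a > 1\<close> enters.\<close>
  define c\<^sub>1 where "c\<^sub>1 = min (g / 2) (a - 1)"
  have "c\<^sub>1 > 0" using g a by (simp add: c\<^sub>1_def)
  moreover have "c\<^sub>1 \<le> g / 2" "c\<^sub>1 \<le> a - 1"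
    unfolding c\<^sub>1_def by (rule min.cobounded1, rule min.cobounded2)
  ultimately have c1: "c\<^sub>1 > 0" "c\<^sub>1 \<le> g / 2" "c\<^sub>1 \<le> a - 1" .
  obtain N\<^sub>0 where N0: "\<And>N n. N \<ge> N\<^sub>0 \<Longrightarrow>
    \<exists>E\<in>sets (mat_law n N).
      measure (mat_law n N) E \<le> exp (- real n * (q / 4)\<^sup>2 / 2) \<and>
      (\<forall>x\<in>space (mat_law n N) - E. real n * (q / 4) < real (card {l\<in>{..<n}.
        greedy_hit N ((1 + \<eta>) * N) (greedy_sum N ((1 + \<eta>) * N) x l) (x l)}))"
    using hits[OF \<eta>(1)] by blast
  \<comment> \<open>\<open>16 / q\<close> absorbs the floor in \<open>t\<close>;
    \<open>8 / g\<close> absorbs the term \<open>1 + \<eta> \<le> 2\<close> caused by the ceiling in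
    \<open>N\<close>.\<close>
  define n\<^sub>0 where "n\<^sub>0 = max N\<^sub>0 (max 1 (max (nat \<lceil>16 / q\<rceil>) (nat \<lceil>8 / g\<rceil>)))"
  have "\<exists>E\<in>sets (mat_law n N).
      measure (mat_law n N) E \<le> exp (- ((q / 4)\<^sup>2 / 2) * n) \<and>
      (\<forall>x\<in>space (mat_law n N) - E. \<forall>s\<ge>0.
        (\<forall>w. s\<^sup>2 * (\<Sum>l<n. (w l)\<^sup>2) \<le> (\<Sum>i<N. (\<Sum>l<n. w l * x l i)\<^sup>2)) \<longrightarrow> s\<^sup>2 \<le> (a - c\<^sub>1) * n)"
    if n: "n \<ge> n\<^sub>0" and N: "N = nat \<lceil>a * real n\<rceil>" for n N
  proof -
    have n': "n \<ge> 1" "n \<ge> N\<^sub>0" "real n \<ge> 16 / q" "real n \<ge> 8 / g"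
      using n unfolding n\<^sub>0_def by (auto simp: nat_le_iff ceiling_le_iff)
    have an: "1 * real n \<le> a * n" using a by (intro mult_right_mono) auto
    then have Nn: "real N \<le> a * n + 1" "N \<ge> N\<^sub>0" using n' unfolding N by linarith+
    obtain E where E: "E \<in> sets (mat_law n N)"
      "measure (mat_law n N) E \<le> exp (- real n * (q / 4)\<^sup>2 / 2)"
      and hit: "\<And>x. x \<in> space (mat_law n N) - E \<Longrightarrow> real n * (q / 4) < real (card {l\<in>{..<n}.
        greedy_hit N ((1 + \<eta>) * N) (greedy_sum N ((1 + \<eta>) * N) x l) (x l)})"
      using N0[OF Nn(2), of n] by blast
    have "s\<^sup>2 \<le> (a - c\<^sub>1) * n"
      if x: "x \<in> space (mat_law n N) - E" and s: "s \<ge> 0"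
        and low: "\<And>w. s\<^sup>2 * (\<Sum>l<n. (w l)\<^sup>2) \<le> (\<Sum>i<N. (\<Sum>l<n. w l * x l i)\<^sup>2)" for x s
    proof (rule ccontr)
      assume "\<not> s\<^sup>2 \<le> (a - c\<^sub>1) * n"
      then have s2: "s\<^sup>2 > (a - c\<^sub>1) * n" by simp
      have "1 * real n \<le> (a - c\<^sub>1) * n" using c1 by (intro mult_right_mono) auto
      then have "real n \<le> s\<^sup>2" using s2 by simp
      then have sn: "sqrt n \<le> s" using s real_le_lsqrt by auto
      \<comment> \<open>Half of the guaranteed hits build up length, the other half collect the
        gain.\<close>
      define t where "t = nat \<lfloor>n * q / 8\<rfloor>"
      define B where "B = (1 + \<eta>) * N"
      define e where "e = card {l\<in>{..<n}. greedy_hit N B (greedy_sum N B x l) (x l)}"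
      define m where "m = (\<Sum>l<n. (greedy_sign N B (greedy_sum N B x l) (x l))\<^sup>2)"
      have e: "real n * (q / 4) < real e" using hit[OF x] by (simp add: e_def B_def)
      have "m \<le> (\<Sum>l<n. 1)" unfolding m_def by (intro sum_mono) (auto simp: greedy_sign_def)
      then have m: "m \<le> n" by simp
      note bounds = greedy_sum_bound[OF s low order_refl, of B]
      have em: "real e \<le> m" using bounds(2) by (simp add: e_def m_def)
      have "s\<^sup>2 * m \<le> m * B - s * sqrt t * real (e - t)"
        using bounds(1)[of t] bounds(3) unfolding e_def m_def by linarith
      then have gain: "s * sqrt t * real (e - t) \<le> m * (B - s\<^sup>2)" by (simp add: algebra_simps)
      have t1: "real t \<le> n * q / 8" unfolding t_def using q by (intro of_nat_floor) simp
      have "n * q \<ge> 16" using n'(3) q by (simp add: field_simps)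
      moreover have "real t \<ge> n * q / 8 - 1" unfolding t_def using q by linarith
      ultimately have t2: "real t \<ge> n * (q / 16)" by simp
      have "real (e - t) \<ge> n * (q / 8)" using e t1 by (simp add: of_nat_diff field_simps)
      moreover have "sqrt t \<ge> sqrt n * sqrt (q / 16)" using t2 by (simp add: flip: real_sqrt_mult)
      ultimately have "(sqrt n * (sqrt n * sqrt (q / 16))) * (n * (q / 8)) \<le> s * sqrt t * real (e - t)"
        using sn q s by (intro mult_mono) auto
      moreover have "(sqrt n * (sqrt n * sqrt (q / 16))) * (n * (q / 8)) = n * (n * g)"
        by (simp add: g_def mult_ac flip: mult.assoc[of "sqrt n" "sqrt n"])
      ultimately have ng: "n * (n * g) \<le> m * (B - s\<^sup>2)" using gain by linarith
      moreover have "0 < n * (n * g)" using n' g by simp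
      ultimately have "0 < m * (B - s\<^sup>2)" by linarith
      moreover have "m \<ge> 0" using em by linarith
      \<comment> \<open>The sign is needed before the number \<open>m\<close> of columns used can be
        replaced by its bound \<open>n\<close>.\<close>
      ultimately have pos: "B - s\<^sup>2 > 0" by (simp add: zero_less_mult_iff)
      have "n * (n * g) \<le> n * (B - s\<^sup>2)" using ng mult_right_mono[OF m less_imp_le[OF pos]] by linarith
      then have "n * g \<le> B - s\<^sup>2" using n' by simp
      moreover have "B \<le> (1 + \<eta>) * (a * n + 1)" unfolding B_def using Nn \<eta> by (intro mult_left_mono) auto
      moreover have "(1 + \<eta>) * (a * n + 1) = a * n + 1 + \<eta> + (\<eta> * a) * n" by (simp add: algebra_simps)
      moreover have "(\<eta> * a) * n \<le> g / 4 * n" using \<eta> by (intro mult_right_mono) auto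
      moreover have "g * n \<ge> 8" using n'(4) g by (simp add: field_simps)
      ultimately have "s\<^sup>2 \<le> a * n - g / 2 * n" using \<eta>(2) by (simp add: mult_ac)
      also have "\<dots> \<le> a * n - c\<^sub>1 * n" using c1 by (intro diff_left_mono mult_right_mono) auto
      finally show False using s2 by (simp add: algebra_simps)
    qed
    moreover have "measure (mat_law n N) E \<le> exp (- ((q / 4)\<^sup>2 / 2) * n)"
      using E(2) by (simp add: mult_ac)
    ultimately show ?thesis using E(1) by blast
  qed
  moreover have "(q / 4)\<^sup>2 / 2 > 0" using q by simp
  moreover have "c\<^sub>1 \<le> a" using c1 by simp
  ultimately show ?thesis using c1(1) by blast
qed

end

subsection \<open>Compressible vectors\<close>

text \<open>A row is kept or erased as a whole: erasing only drops squares from the form, so the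
  truncated form lies below the original for every vector, and the sum of all squared entries is at
  most b times the number of rows.\<close>

definition truncated_row :: "real \<Rightarrow> nat \<Rightarrow> (nat \<Rightarrow> real) \<Rightarrow> nat \<Rightarrow> real" where
  "truncated_row b n r = (if (\<Sum>j<n. (r j)\<^sup>2) \<le> b then r else (\<lambda>_. 0))"

context symmetric_unit_law
begin

lemma norm_square_markov:
  fixes C :: real
  assumes "n \<ge> 1" "C > 0"
  shows "measure (vec_law n) {x \<in> space (vec_law n). (\<Sum>j<n. (x j)\<^sup>2) > C * n} \<le> 1 / C"
proof -
  interpret Pn: prob_space "vec_law n" by (rule prob_space_vec_law)
  have int: "integrable (vec_law n) (\<lambda>x. \<Sum>j<n. (x j)\<^sup>2)"
    by (intro Bochner_Integration.integrable_sum integrable_component[where f = "\<lambda>x. x\<^sup>2"] integrable_square) auto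
  have "measure (vec_law n) {x \<in> space (vec_law n). (\<Sum>j<n. (x j)\<^sup>2) > C * n}
      \<le> measure (vec_law n) {x \<in> space (vec_law n). (\<Sum>j<n. (x j)\<^sup>2) \<ge> C * n}"
    by (intro Pn.finite_measure_mono) auto
  also have "\<dots> \<le> (\<integral>x. (\<Sum>j<n. (x j)\<^sup>2) \<partial>vec_law n) / (C * n)"
    using int assms by (intro integral_Markov_inequality_measure[where A = "space (vec_law n)"]) (auto intro!: sum_nonneg)
  also have "(\<integral>x. (\<Sum>j<n. (x j)\<^sup>2) \<partial>vec_law n) = n"
    using integrable_square
    by (subst Bochner_Integration.integral_sum)
       (auto simp: integral_component[where f = "\<lambda>x. x\<^sup>2"] variance_one intro!: integrable_component[where f = "\<lambda>x. x\<^sup>2"])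
  also have "n / (C * n) = 1 / C" using assms by simp
  finally show ?thesis .
qed

text \<open>Half of 1 - cos is a minorant in [0, 1] of s^2 / 4 times the squared projection. Setting
  it to 0 on erased rows costs at most their probability \<open>1 / C\<close> in the mean, so
  \<open>C\<close> depends on \<open>\<eta>\<close> only and not on \<open>y\<close>.\<close>

lemma truncated_form_lower_tail:
  fixes \<eta> :: real
  assumes \<eta>: "0 < \<eta>" "\<eta> < 1"
  shows "\<exists>C>(0::real). \<exists>c>(0::real). \<forall>n\<ge>1. \<forall>N y. (\<Sum>j<n. (y j)\<^sup>2) = 1 \<longrightarrow>
    (\<exists>E\<in>sets (mat_law N n).
      measure (mat_law N n) E \<le> exp (- c * N) \<and>
      (\<forall>x\<in>space (mat_law N n) - E.
        (1 - 4 * \<eta>) * N < (\<Sum>i<N. (\<Sum>j<n. truncated_row (C * n) n (x i) j * y j)\<^sup>2)))"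
proof -
  obtain s where s: "s > 0" "s \<le> 1" and mean: "\<And>n y. (\<Sum>j<n. (y j)\<^sup>2) = 1 \<Longrightarrow>
      (1 - 2 * \<eta>) * s\<^sup>2 / 2 \<le> (\<integral>x. 1 - cos (s * (\<Sum>j<n. y j * x j)) \<partial>vec_law n)"
    using one_minus_cos_mean[OF \<eta>] by auto
  \<comment> \<open>In units of s^2 / 4, truncation and deviation lose one \<open>\<eta>\<close>
    each, on top of the \<open>2 * \<eta>\<close> already lost in the mean.\<close>
  define r where "r = \<eta> * s\<^sup>2 / 4"
  have r: "r > 0" using s \<eta> by (simp add: r_def)
  define C where "C = 1 / r"
  have C: "C > 0" using r by (simp add: C_def)
  define q where "q = (1 - 2 * \<eta>) * s\<^sup>2 / 4 - r"
  have "\<exists>E\<in>sets (mat_law N n).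
      measure (mat_law N n) E \<le> exp (- (r\<^sup>2 / 2) * N) \<and>
      (\<forall>x\<in>space (mat_law N n) - E.
        (1 - 4 * \<eta>) * N < (\<Sum>i<N. (\<Sum>j<n. truncated_row (C * n) n (x i) j * y j)\<^sup>2))"
    if n: "n \<ge> 1" and y: "(\<Sum>j<n. (y j)\<^sup>2) = 1" for n N y
  proof -
    interpret Pn: prob_space "vec_law n" by (rule prob_space_vec_law)
    define h where "h x = (1 - cos (s * (\<Sum>j<n. y j * x j))) / 2" for x
    define H where "H = {x \<in> space (vec_law n). (\<Sum>j<n. (x j)\<^sup>2) > C * n}"
    define g where "g x = (if (\<Sum>j<n. (x j)\<^sup>2) \<le> C * n then h x else 0)" for x
    have h01: "0 \<le> h x" "h x \<le> 1" for x
      using cos_ge_minus_one[of "s * (\<Sum>j<n. y j * x j)"] by (auto simp: h_def)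
    have g01: "0 \<le> g x" "g x \<le> 1" for x using h01 by (auto simp: g_def)
    have [measurable]: "h \<in> borel_measurable (vec_law n)" "H \<in> sets (vec_law n)"
      unfolding h_def[abs_def] H_def by measurable
    have g_meas[measurable]: "g \<in> borel_measurable (vec_law n)" unfolding g_def[abs_def] by measurable
    have gm: "q \<le> (\<integral>x. g x \<partial>vec_law n)"
    proof -
      have "(1 - 2 * \<eta>) * s\<^sup>2 / 4 \<le> (\<integral>x. h x \<partial>vec_law n)"
        using mean[OF y] unfolding h_def by (simp add: field_simps)
      also have "\<dots> \<le> (\<integral>x. g x + indicator H x \<partial>vec_law n)"
      proof (rule integral_mono)
        show "integrable (vec_law n) h"
          using h01 by (intro Pn.integrable_const_bound[where B = 1]) (auto intro!: AE_I2)
        show "integrable (vec_law n) (\<lambda>x. g x + indicator H x)"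
          using g01 by (intro Bochner_Integration.integrable_add Pn.integrable_const_bound[where B = 1])
            (auto intro!: AE_I2 simp: indicator_def)
        fix x assume "x \<in> space (vec_law n)"
        then show "h x \<le> g x + indicator H x" using h01 by (auto simp: g_def H_def indicator_def)
      qed
      also have "\<dots> = (\<integral>x. g x \<partial>vec_law n) + measure (vec_law n) H"
        using g01 by (subst Bochner_Integration.integral_add)
          (auto intro!: Pn.integrable_const_bound[where B = 1] AE_I2 simp: Pn.emeasure_eq_measure)
      also have "measure (vec_law n) H \<le> r" unfolding H_def using norm_square_markov[OF n C] by (simp add: C_def)
      finally show ?thesis by (simp add: q_def)
    qed
    define E where "E = {x \<in> space (mat_law N n). (\<Sum>k<N. g (x k)) \<le> N * (q - r)}"
    have gx[measurable]: "(\<lambda>x. g (x k)) \<in> borel_measurable (mat_law N n)" if "k < N" for k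
      using that by (intro measurable_compose[OF _ g_meas] measurable_component_singleton) auto
    have [measurable]: "(\<lambda>x. \<Sum>k<N. g (x k)) \<in> borel_measurable (mat_law N n)"
      by (intro borel_measurable_sum gx) auto
    have sE: "E \<in> sets (mat_law N n)" unfolding E_def by measurable
    have "measure (mat_law N n) E \<le> exp (- real N * r\<^sup>2 / 2)"
      unfolding E_def using g01 gm r
      by (intro Pn.adapted_lower_tail[where Z = "\<lambda>_ _ c. g c"]) auto
    then have mE: "measure (mat_law N n) E \<le> exp (- (r\<^sup>2 / 2) * N)" by (simp add: mult_ac)
    have "(1 - 4 * \<eta>) * N < (\<Sum>i<N. (\<Sum>j<n. truncated_row (C * n) n (x i) j * y j)\<^sup>2)"
      if x: "x \<in> space (mat_law N n) - E" for x
    proof -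
      have le: "g v \<le> s\<^sup>2 / 4 * (\<Sum>j<n. truncated_row (C * n) n v j * y j)\<^sup>2" for v
      proof (cases "(\<Sum>j<n. (v j)\<^sup>2) \<le> C * n")
        case True
        have "h v \<le> s\<^sup>2 / 4 * (\<Sum>j<n. y j * v j)\<^sup>2"
          using cos_ge_quadratic[of "s * (\<Sum>j<n. y j * v j)"] by (simp add: h_def power_mult_distrib)
        then show ?thesis using True by (simp add: g_def truncated_row_def mult_ac)
      qed (simp add: g_def)
      have "N * (q - r) < (\<Sum>k<N. g (x k))" using x by (auto simp: E_def not_le)
      also have "\<dots> \<le> (\<Sum>i<N. s\<^sup>2 / 4 * (\<Sum>j<n. truncated_row (C * n) n (x i) j * y j)\<^sup>2)"
        by (intro sum_mono le)
      also have "\<dots> = s\<^sup>2 / 4 * (\<Sum>i<N. (\<Sum>j<n. truncated_row (C * n) n (x i) j * y j)\<^sup>2)"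
        by (simp add: sum_distrib_left)
      finally have "N * (q - r) < s\<^sup>2 / 4 * (\<Sum>i<N. (\<Sum>j<n. truncated_row (C * n) n (x i) j * y j)\<^sup>2)" .
      moreover have "N * (q - r) = s\<^sup>2 / 4 * ((1 - 4 * \<eta>) * N)" by (simp add: q_def r_def field_simps)
      ultimately show ?thesis using s by (simp add: mult_less_cancel_left_pos)
    qed
    with mE sE show ?thesis by blast
  qed
  moreover have "r\<^sup>2 / 2 > 0" using r by simp
  ultimately show ?thesis using C by blast
qed

text \<open>Rounding carries an l1 penalty on \<open>I\<close>. As u is small there, the penalty
  keeps the rounded vector mostly zero on \<open>I\<close>, and few coordinates lie outside, so it
  falls in a sparse lattice. Outside the union of the bad events of the normalised lattice vectors,
  its form is too large for u to have a small one.\<close>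

lemma compressible_lower_bound:
  fixes a c\<^sub>1 :: real
  assumes a: "a > 1" and c1: "0 < c\<^sub>1" "c\<^sub>1 \<le> a"
  shows "\<exists>\<epsilon>\<in>{0<..<1/2}. \<exists>\<delta>\<in>{0<..<1/2}. \<exists>c>0. \<forall>n\<ge>1. \<forall>N. N = nat \<lceil>a * real n\<rceil> \<longrightarrow>
    (\<exists>E\<in>sets (mat_law N n).
      measure (mat_law N n) E \<le> exp (- c * n) \<and>
      (\<forall>x\<in>space (mat_law N n) - E. \<forall>u I.
        (\<Sum>j<n. (u j)\<^sup>2) = 1 \<longrightarrow> I \<subseteq> {..<n} \<longrightarrow> real (card ({..<n} - I)) \<le> \<epsilon> * n \<longrightarrow> L2_set u I < \<delta> \<longrightarrow>
        (a - c\<^sub>1) * n < (\<Sum>i<N. (\<Sum>j<n. x i j * u j)\<^sup>2)))"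
proof -
  \<comment> \<open>The losses are 4 \<eta> in the tail bound, 2 \<eta> in the normalisation and 2
    \<eta> in the rounding: in all 8 \<eta> a = \<open>c\<^sub>1 / 2\<close> per n.\<close>
  define \<eta> where "\<eta> = c\<^sub>1 / (16 * a)"
  have \<eta>: "0 < \<eta>" "\<eta> \<le> 1 / 16" using a c1 by (auto simp: \<eta>_def field_simps)
  obtain C c :: real where C: "C > 0" and c: "c > 0" and tail: "\<And>n N y. n \<ge> 1 \<Longrightarrow> (\<Sum>j<n. (y j)\<^sup>2) = 1 \<Longrightarrow>
    \<exists>E\<in>sets (mat_law N n).
      measure (mat_law N n) E \<le> exp (- c * N) \<and>
      (\<forall>x\<in>space (mat_law N n) - E.
        (1 - 4 * \<eta>) * N < (\<Sum>i<N. (\<Sum>j<n. truncated_row (C * n) n (x i) j * y j)\<^sup>2))"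
    using truncated_form_lower_tail[of \<eta>] \<eta> by auto
  \<comment> \<open>\<open>\<gamma> \<le> \<eta>\<close> keeps the rounded vector at length at least
    \<open>1 - \<eta>\<close>; \<open>\<gamma>\<^sup>2 * C \<le> \<eta>\<close> keeps the rounding
    variance below \<open>\<eta> * N\<close>.\<close>
  define \<gamma> where "\<gamma> = min \<eta> (sqrt (\<eta> / C))"
  have \<gamma>0: "\<gamma> > 0" using \<eta> C by (simp add: \<gamma>_def)
  have \<gamma>\<eta>: "\<gamma> \<le> \<eta>" unfolding \<gamma>_def by (rule min.cobounded1)
  have \<gamma>C: "\<gamma>\<^sup>2 * C \<le> \<eta>"
  proof -
    have "\<gamma>\<^sup>2 \<le> (sqrt (\<eta> / C))\<^sup>2" using \<gamma>0 by (intro power_mono) (auto simp: \<gamma>_def)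
    also have "\<dots> = \<eta> / C" using \<eta> C by simp
    finally show ?thesis using C by (simp add: field_simps)
  qed
  \<comment> \<open>A vector of length at most 2 has l1 norm at most 2 sqrt(n), that is 2 n /
    \<gamma> in units of the mesh.\<close>
  define B where "B = 2 / \<gamma>"
  have B: "B > 0" using \<gamma>0 by (simp add: B_def)
  \<comment> \<open>Entropy is limited to half of the decay rate \<open>c\<close>; the other half is
    the rate of the conclusion.\<close>
  obtain \<kappa> where \<kappa>: "\<kappa> > 0" and lattice: "\<And>n. finite (sparse_lattice \<kappa> B n)"
      "\<And>n. real (card (sparse_lattice \<kappa> B n)) \<le> exp (c / 2 * n)"
    using sparse_lattice_card[OF B, of "c / 2"] c by auto
  \<comment> \<open>Half of the support budget goes to the coordinates outside \<open>I\<close>;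
    \<open>\<delta>\<close> below is chosen so that the coordinates in \<open>I\<close> use at most
    the other half.\<close>
  define \<epsilon> where "\<epsilon> = min (\<kappa> / 2) (1 / 4)"
  define \<delta> where "\<delta> = min (\<kappa> * \<eta> * \<gamma> / 4) (1 / 4)"
  have \<epsilon>: "\<epsilon> > 0" "\<epsilon> < 1 / 2" using \<kappa> by (simp_all add: \<epsilon>_def min_less_iff_disj)
  have \<epsilon>\<kappa>: "\<epsilon> \<le> \<kappa> / 2" unfolding \<epsilon>_def by (rule min.cobounded1)
  have "\<kappa> * \<eta> * \<gamma> > 0" using \<kappa> \<eta> \<gamma>0 by simp
  then have \<delta>: "\<delta> > 0" "\<delta> < 1 / 2" by (simp_all add: \<delta>_def min_less_iff_disj)
  have \<delta>\<kappa>: "\<delta> \<le> \<kappa> * \<eta> * \<gamma> / 4" unfolding \<delta>_def by (rule min.cobounded1)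
  have "\<exists>E\<in>sets (mat_law N n).
      measure (mat_law N n) E \<le> exp (- (c / 2) * n) \<and>
      (\<forall>x\<in>space (mat_law N n) - E. \<forall>u I.
        (\<Sum>j<n. (u j)\<^sup>2) = 1 \<longrightarrow> I \<subseteq> {..<n} \<longrightarrow> real (card ({..<n} - I)) \<le> \<epsilon> * n \<longrightarrow> L2_set u I < \<delta> \<longrightarrow>
        (a - c\<^sub>1) * n < (\<Sum>i<N. (\<Sum>j<n. x i j * u j)\<^sup>2))"
    if n: "n \<ge> 1" and N: "N = nat \<lceil>a * real n\<rceil>" for n N
  proof -
    let ?P = "mat_law N n"
    interpret P: prob_space ?P by (intro prob_space_PiM prob_space_vec_law)
    have an: "1 * real n \<le> a * n" using a by (intro mult_right_mono) auto
    have Nan: "a * n \<le> real N" unfolding N by linarith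
    have Nn: "real n \<le> real N" using an Nan by linarith
    define y where "y k j = real_of_int (k j) / sqrt (\<Sum>j<n. (real_of_int (k j))\<^sup>2)" for k :: "nat \<Rightarrow> int" and j
    \<comment> \<open>The zero vector is left out because it cannot be normalised.\<close>
    define \<Lambda> where "\<Lambda> = {k \<in> sparse_lattice \<kappa> B n. (\<Sum>j<n. (real_of_int (k j))\<^sup>2) \<noteq> 0}"
    have "\<forall>k\<in>\<Lambda>. \<exists>E. E \<in> sets ?P \<and> measure ?P E \<le> exp (- c * N) \<and>
      (\<forall>x\<in>space ?P - E. (1 - 4 * \<eta>) * N < (\<Sum>i<N. (\<Sum>j<n. truncated_row (C * n) n (x i) j * y k j)\<^sup>2))"
    proof
      fix k assume "k \<in> \<Lambda>"
      then have "(\<Sum>j<n. (real_of_int (k j))\<^sup>2) \<noteq> 0" by (simp add: \<Lambda>_def)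
      moreover have "(\<Sum>j<n. (real_of_int (k j))\<^sup>2) \<ge> 0" by (intro sum_nonneg) auto
      ultimately have "(\<Sum>j<n. (y k j)\<^sup>2) = 1"
        by (simp add: y_def power_divide flip: sum_divide_distrib)
      from tail[OF n this] show "\<exists>E. E \<in> sets ?P \<and> measure ?P E \<le> exp (- c * N) \<and>
        (\<forall>x\<in>space ?P - E. (1 - 4 * \<eta>) * N < (\<Sum>i<N. (\<Sum>j<n. truncated_row (C * n) n (x i) j * y k j)\<^sup>2))"
        unfolding Bex_def .
    qed
    from bchoice[OF this] obtain F where F: "\<And>k. k \<in> \<Lambda> \<Longrightarrow> F k \<in> sets ?P"
      "\<And>k. k \<in> \<Lambda> \<Longrightarrow> measure ?P (F k) \<le> exp (- c * N)"
      "\<And>k x. k \<in> \<Lambda> \<Longrightarrow> x \<in> space ?P - F k \<Longrightarrow>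
        (1 - 4 * \<eta>) * N < (\<Sum>i<N. (\<Sum>j<n. truncated_row (C * n) n (x i) j * y k j)\<^sup>2)"
      by blast
    define E where "E = (\<Union>k\<in>\<Lambda>. F k)"
    have fin: "finite \<Lambda>" using lattice(1) by (simp add: \<Lambda>_def)
    have sE: "E \<in> sets ?P" unfolding E_def using fin F by (intro sets.finite_UN) auto
    have mE: "measure ?P E \<le> exp (- (c / 2) * n)"
    proof -
      have "measure ?P E \<le> (\<Sum>k\<in>\<Lambda>. measure ?P (F k))"
        unfolding E_def using fin F by (intro measure_UNION_le) auto
      also have "\<dots> \<le> (\<Sum>k\<in>\<Lambda>. exp (- c * N))" by (intro sum_mono F)
      also have "\<dots> = real (card \<Lambda>) * exp (- c * N)" by simp
      also have "\<dots> \<le> exp (c / 2 * n) * exp (- c * n)"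
      proof (intro mult_mono)
        have "card \<Lambda> \<le> card (sparse_lattice \<kappa> B n)" using lattice(1) by (intro card_mono) (auto simp: \<Lambda>_def)
        then show "real (card \<Lambda>) \<le> exp (c / 2 * n)" using lattice(2)[of n] by linarith
        show "exp (- c * N) \<le> exp (- c * n)" using Nn c by simp
      qed auto
      also have "\<dots> = exp (- (c / 2) * n)" by (simp add: exp_add[symmetric])
      finally show ?thesis .
    qed
    have "(a - c\<^sub>1) * n < (\<Sum>i<N. (\<Sum>j<n. x i j * u j)\<^sup>2)"
      if x: "x \<in> space ?P - E" and u1: "(\<Sum>j<n. (u j)\<^sup>2) = 1" and I: "I \<subseteq> {..<n}"
        and J: "real (card ({..<n} - I)) \<le> \<epsilon> * n" and uI: "L2_set u I < \<delta>" for x u I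
    proof (rule ccontr)
      assume "\<not> ?thesis"
      then have contra: "(\<Sum>i<N. (\<Sum>j<n. x i j * u j)\<^sup>2) \<le> (a - c\<^sub>1) * n" by simp
      define A where "A i = truncated_row (C * n) n (x i)" for i
      define h where "h = \<gamma> / sqrt n"
      have h: "h > 0" using \<gamma>0 n by (simp add: h_def)
      have h2: "h\<^sup>2 * n = \<gamma>\<^sup>2" using n by (simp add: h_def power_divide)
      have hn: "h * sqrt n = \<gamma>" using n by (simp add: h_def)
      \<comment> \<open>The penalty of \<open>u\<close> itself is then at most
        \<open>\<beta> * (sqrt n * \<delta>) = \<eta> * N\<close>, as cheap as the variance
        term.\<close>
      define \<beta> where "\<beta> = \<eta> * N / (sqrt n * \<delta>)"
      have Npos: "real N > 0" using Nn n by simp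
      have \<beta>: "\<beta> > 0" using \<eta> Npos n \<delta> by (simp add: \<beta>_def)
      define \<beta>' where "\<beta>' j = (if j \<in> I then \<beta> else 0)" for j
      have \<beta>'sum: "(\<Sum>j<n. \<beta>' j * f j) = \<beta> * (\<Sum>j\<in>I. f j)" for f :: "nat \<Rightarrow> real"
      proof -
        have "(\<Sum>j<n. \<beta>' j * f j) = (\<Sum>j\<in>I. \<beta> * f j)"
          unfolding \<beta>'_def using I by (intro sum.mono_neutral_cong_right) auto
        then show ?thesis by (simp add: sum_distrib_left)
      qed
      have nn: "\<And>j. \<beta>' j \<ge> 0" using \<beta> by (simp add: \<beta>'_def)
      from exists_rounding[where \<beta> = \<beta>' and n = n and N = N and b = "\<lambda>_. 0" and A = A and u = u, OF h nn]
      obtain k :: "nat \<Rightarrow> int" where k: "\<And>j. j < n \<Longrightarrow> \<bar>h * k j - u j\<bar> \<le> h"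
        and k_le: "(\<Sum>i<N. (\<Sum>j<n. A i j * (h * k j))\<^sup>2) + (\<Sum>j<n. \<beta>' j * \<bar>h * k j\<bar>)
          \<le> (\<Sum>i<N. (\<Sum>j<n. A i j * u j)\<^sup>2) + (\<Sum>j<n. \<beta>' j * \<bar>u j\<bar>)
            + h\<^sup>2 * (\<Sum>j<n. \<Sum>i<N. (A i j)\<^sup>2)" by auto
      define \<theta> where "\<theta> j = h * k j" for j
      have Au: "(\<Sum>i<N. (\<Sum>j<n. A i j * u j)\<^sup>2) \<le> (a - c\<^sub>1) * n"
      proof -
        have "(\<Sum>i<N. (\<Sum>j<n. A i j * u j)\<^sup>2) \<le> (\<Sum>i<N. (\<Sum>j<n. x i j * u j)\<^sup>2)"
          by (intro sum_mono) (simp add: A_def truncated_row_def)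
        then show ?thesis using contra by linarith
      qed
      have variance: "h\<^sup>2 * (\<Sum>j<n. \<Sum>i<N. (A i j)\<^sup>2) \<le> \<eta> * N"
      proof -
        have "(\<Sum>j<n. \<Sum>i<N. (A i j)\<^sup>2) = (\<Sum>i<N. \<Sum>j<n. (A i j)\<^sup>2)" by (rule sum.swap)
        also have "\<dots> \<le> (\<Sum>i<N. C * n)"
          using C by (intro sum_mono) (simp add: A_def truncated_row_def)
        finally have "h\<^sup>2 * (\<Sum>j<n. \<Sum>i<N. (A i j)\<^sup>2) \<le> h\<^sup>2 * (N * (C * n))" by (intro mult_left_mono) auto
        also have "\<dots> = (h\<^sup>2 * n) * C * N" by (simp add: mult_ac)
        also have "\<dots> \<le> \<eta> * N" unfolding h2 using \<gamma>C by (intro mult_right_mono) auto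
        finally show ?thesis .
      qed
      have l1: "(\<Sum>j\<in>S. \<bar>f j\<bar>) \<le> sqrt n * L2_set f S" if "S \<subseteq> {..<n}" for S and f :: "nat \<Rightarrow> real"
      proof -
        have "card S \<le> n" using card_mono[OF _ that] by simp
        have "(\<Sum>j\<in>S. \<bar>f j\<bar>) \<le> L2_set (\<lambda>_. 1) S * L2_set f S"
          using L2_set_mult_ineq[of "\<lambda>_. 1" f S] by simp
        also have "\<dots> \<le> sqrt n * L2_set f S"
          using \<open>card S \<le> n\<close> by (intro mult_right_mono) (auto simp: L2_set_def sum_nonneg)
        finally show ?thesis .
      qed
      have \<beta>u: "(\<Sum>j<n. \<beta>' j * \<bar>u j\<bar>) \<le> \<eta> * N"
      proof -
        have "(\<Sum>j<n. \<beta>' j * \<bar>u j\<bar>) \<le> \<beta> * (sqrt n * \<delta>)"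
        proof -
          have "(\<Sum>j\<in>I. \<bar>u j\<bar>) \<le> sqrt n * L2_set u I" by (rule l1[OF I])
          also have "\<dots> \<le> sqrt n * \<delta>" using uI by (intro mult_left_mono) auto
          finally show ?thesis unfolding \<beta>'sum using \<beta> by (intro mult_left_mono) auto
        qed
        also have "\<dots> = \<eta> * N" using n \<delta> by (simp add: \<beta>_def)
        finally show ?thesis .
      qed
      have total: "(\<Sum>i<N. (\<Sum>j<n. A i j * \<theta> j)\<^sup>2) + \<beta> * (\<Sum>j\<in>I. \<bar>\<theta> j\<bar>) \<le> (a - c\<^sub>1) * n + 2 * \<eta> * N"
        using k_le Au variance \<beta>u unfolding \<beta>'sum \<theta>_def by linarith
      have "(a - c\<^sub>1) * n \<le> a * n" using c1 by (intro mult_right_mono) auto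
      moreover have "2 * \<eta> * N \<le> 1 * real N" using \<eta> by (intro mult_right_mono) auto
      ultimately have total2: "(a - c\<^sub>1) * n + 2 * \<eta> * N \<le> 2 * N" using Nan by linarith
      \<comment> \<open>Dropping the nonnegative quadratic part leaves a penalty of at most 2 N. As
        nonzero integers have absolute value at least 1, this also bounds the support on
        \<open>I\<close>.\<close>
      have kI: "(\<Sum>j\<in>I. \<bar>real_of_int (k j)\<bar>) \<le> \<kappa> / 2 * n"
      proof -
        have "0 \<le> (\<Sum>i<N. (\<Sum>j<n. A i j * \<theta> j)\<^sup>2)" by (intro sum_nonneg) auto
        then have "\<beta> * (\<Sum>j\<in>I. \<bar>\<theta> j\<bar>) \<le> 2 * N" using total total2 by linarith
        moreover have "(\<Sum>j\<in>I. \<bar>\<theta> j\<bar>) = h * (\<Sum>j\<in>I. \<bar>real_of_int (k j)\<bar>)"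
          using h by (simp add: \<theta>_def abs_mult sum_distrib_left)
        ultimately have "(\<beta> * h) * (\<Sum>j\<in>I. \<bar>real_of_int (k j)\<bar>) \<le> 2 * N" by (simp add: mult_ac)
        then have "(\<Sum>j\<in>I. \<bar>real_of_int (k j)\<bar>) \<le> 2 * N / (\<beta> * h)" using \<beta> h by (simp add: field_simps)
        also have "2 * N / (\<beta> * h) = 2 * \<delta> * n / (\<eta> * \<gamma>)"
          using Npos n \<delta> \<eta> \<gamma>0 by (simp add: \<beta>_def h_def field_simps)
        also have "\<dots> \<le> \<kappa> / 2 * n" using \<delta>\<kappa> \<eta> \<gamma>0 n by (simp add: field_simps)
        finally show ?thesis .
      qed
      have supp: "real (card {j\<in>{..<n}. k j \<noteq> 0}) \<le> \<kappa> * n"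
      proof -
        have fI: "finite I" using I finite_subset by blast
        have "card {j\<in>{..<n}. k j \<noteq> 0} \<le> card (({..<n} - I) \<union> {j\<in>I. k j \<noteq> 0})"
          using fI by (intro card_mono) auto
        also have "\<dots> \<le> card ({..<n} - I) + card {j\<in>I. k j \<noteq> 0}" by (rule card_Un_le)
        finally have "real (card {j\<in>{..<n}. k j \<noteq> 0}) \<le> card ({..<n} - I) + real (card {j\<in>I. k j \<noteq> 0})" by simp
        moreover have "real (card {j\<in>I. k j \<noteq> 0}) = (\<Sum>j\<in>I. of_bool (k j \<noteq> 0))"
          using fI by (simp add: Int_def)
        moreover have "(\<Sum>j\<in>I. of_bool (k j \<noteq> 0)) \<le> (\<Sum>j\<in>I. \<bar>real_of_int (k j)\<bar>)"
          by (intro sum_mono) (auto simp: of_bool_def)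
        moreover have "\<epsilon> * n \<le> \<kappa> / 2 * n" using \<epsilon>\<kappa> by (intro mult_right_mono) auto
        ultimately show ?thesis using J kI by linarith
      qed
      have Lu: "L2_set u {..<n} = 1" using u1 by (simp add: L2_set_def)
      have diff: "L2_set (\<lambda>j. \<theta> j - u j) {..<n} \<le> \<gamma>"
      proof -
        have "(\<Sum>j<n. (\<theta> j - u j)\<^sup>2) \<le> (\<Sum>j<n. h\<^sup>2)"
          using k h by (intro sum_mono) (auto simp: \<theta>_def abs_le_square_iff[symmetric])
        also have "\<dots> = \<gamma>\<^sup>2" using h2 by (simp add: mult_ac)
        finally show ?thesis unfolding L2_set_def using \<gamma>0 by (intro real_le_lsqrt) (auto intro: sum_nonneg)
      qed
      have \<theta>up: "L2_set \<theta> {..<n} \<le> 1 + \<gamma>"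
        using L2_set_triangle_ineq[of u "\<lambda>j. \<theta> j - u j" "{..<n}"] diff Lu by simp
      have \<theta>low: "1 - \<gamma> \<le> L2_set \<theta> {..<n}"
      proof -
        have "L2_set (\<lambda>j. u j - \<theta> j) {..<n} = L2_set (\<lambda>j. \<theta> j - u j) {..<n}"
          by (simp add: L2_set_def power2_commute)
        then show ?thesis using L2_set_triangle_ineq[of \<theta> "\<lambda>j. u j - \<theta> j" "{..<n}"] diff Lu by simp
      qed
      have ksum: "(\<Sum>j<n. \<bar>real_of_int (k j)\<bar>) \<le> B * n"
      proof -
        have "h * (\<Sum>j<n. \<bar>real_of_int (k j)\<bar>) = (\<Sum>j<n. \<bar>\<theta> j\<bar>)"
          using h by (simp add: \<theta>_def abs_mult sum_distrib_left)
        also have "\<dots> \<le> sqrt n * L2_set \<theta> {..<n}" by (intro l1) auto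
        also have "\<dots> \<le> sqrt n * 2" using \<theta>up \<gamma>\<eta> \<eta> by (intro mult_left_mono) auto
        also have "\<dots> = h * (B * n)"
          using \<gamma>0 n by (simp add: h_def B_def field_simps)
        finally show ?thesis using h by simp
      qed
      \<comment> \<open>Membership in the lattice requires an extensional function, whereas the
        rounding leaves values from \<open>n\<close> on arbitrary.\<close>
      define k' where "k' = restrict k {..<n}"
      have k'_eq: "k' j = k j" if "j < n" for j using that by (simp add: k'_def)
      have sq: "(\<Sum>j<n. (\<theta> j)\<^sup>2) = h\<^sup>2 * (\<Sum>j<n. (real_of_int (k' j))\<^sup>2)"
        by (simp add: \<theta>_def power_mult_distrib sum_distrib_left k'_eq)
      have \<theta>2: "(1 - \<eta>)\<^sup>2 \<le> (\<Sum>j<n. (\<theta> j)\<^sup>2)"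
      proof -
        have "(1 - \<eta>)\<^sup>2 \<le> (L2_set \<theta> {..<n})\<^sup>2" using \<theta>low \<gamma>\<eta> \<eta> by (intro power_mono) auto
        also have "\<dots> = (\<Sum>j<n. (\<theta> j)\<^sup>2)" by (simp add: L2_set_def sum_nonneg)
        finally show ?thesis .
      qed
      have "(1 - \<eta>)\<^sup>2 > 0" using \<eta> by simp
      then have \<theta>pos: "(\<Sum>j<n. (\<theta> j)\<^sup>2) > 0" using \<theta>2 by linarith
      have "k' \<in> \<Lambda>"
        unfolding \<Lambda>_def sparse_lattice_def using supp ksum \<theta>pos sq
        by (auto simp: k'_eq k'_def cong: conj_cong)
      moreover from this have "x \<in> space ?P - F k'" using x by (auto simp: E_def)
      ultimately have "(1 - 4 * \<eta>) * N < (\<Sum>i<N. (\<Sum>j<n. A i j * y k' j)\<^sup>2)" using F(3) by (simp add: A_def)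
      \<comment> \<open>The quotient of the form by the squared length is scale invariant, so the
        mesh \<open>h\<close> cancels.\<close>
      also have "(\<Sum>i<N. (\<Sum>j<n. A i j * y k' j)\<^sup>2) = (\<Sum>i<N. (\<Sum>j<n. A i j * \<theta> j)\<^sup>2) / (\<Sum>j<n. (\<theta> j)\<^sup>2)"
      proof -
        define r where "r = sqrt (\<Sum>j<n. (real_of_int (k' j))\<^sup>2)"
        have r2: "(\<Sum>j<n. (\<theta> j)\<^sup>2) = (h * r)\<^sup>2" unfolding sq r_def by (simp add: power_mult_distrib sum_nonneg)
        then have "r \<noteq> 0" using \<theta>pos by auto
        have yr: "y k' j = real_of_int (k' j) / r" for j by (simp add: y_def r_def)
        have eq: "(\<Sum>j<n. A i j * y k' j) = (\<Sum>j<n. A i j * \<theta> j) / (h * r)" for i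
          unfolding sum_divide_distrib yr using h \<open>r \<noteq> 0\<close>
          by (intro sum.cong) (auto simp: \<theta>_def k'_eq)
        show ?thesis by (simp only: r2 eq power_divide sum_divide_distrib[symmetric])
      qed
      finally have "(1 - 4 * \<eta>) * N * (\<Sum>j<n. (\<theta> j)\<^sup>2) < (\<Sum>i<N. (\<Sum>j<n. A i j * \<theta> j)\<^sup>2)"
        using \<theta>pos by (simp add: pos_less_divide_eq)
      also have "\<dots> \<le> (a - c\<^sub>1) * n + 2 * \<eta> * N"
      proof -
        have "0 \<le> \<beta> * (\<Sum>j\<in>I. \<bar>\<theta> j\<bar>)" using \<beta> by (intro mult_nonneg_nonneg sum_nonneg) auto
        then show ?thesis using total by linarith
      qed
      finally have 1: "(1 - 4 * \<eta>) * N * (\<Sum>j<n. (\<theta> j)\<^sup>2) < (a - c\<^sub>1) * n + 2 * \<eta> * N" .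
      have "(1 - 4 * \<eta>) * N * (1 - \<eta>)\<^sup>2 \<le> (1 - 4 * \<eta>) * N * (\<Sum>j<n. (\<theta> j)\<^sup>2)"
        using \<eta> by (intro mult_left_mono[OF \<theta>2]) auto
      moreover have "(1 - 6 * \<eta>) * N \<le> (1 - 4 * \<eta>) * N * (1 - \<eta>)\<^sup>2"
      proof -
        have "(1 - 4 * \<eta>) * (1 - 2 * \<eta>) \<le> (1 - 4 * \<eta>) * (1 - \<eta>)\<^sup>2"
          using \<eta> by (intro mult_left_mono) (auto simp: power2_diff)
        moreover have "(1 - 4 * \<eta>) * (1 - 2 * \<eta>) = 1 - 6 * \<eta> + 8 * \<eta>\<^sup>2"
          by (simp add: algebra_simps power2_eq_square)
        ultimately have "1 - 6 * \<eta> \<le> (1 - 4 * \<eta>) * (1 - \<eta>)\<^sup>2" using zero_le_power2[of \<eta>] by linarith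
        then have "(1 - 6 * \<eta>) * N \<le> ((1 - 4 * \<eta>) * (1 - \<eta>)\<^sup>2) * N" by (rule mult_right_mono) simp
        then show ?thesis by (simp add: mult_ac)
      qed
      ultimately have "(1 - 6 * \<eta>) * N - 2 * \<eta> * N < (a - c\<^sub>1) * n" using 1 by linarith
      moreover have "(1 - 6 * \<eta>) * N - 2 * \<eta> * N = (1 - 8 * \<eta>) * N" by (simp add: algebra_simps)
      moreover have "(1 - 8 * \<eta>) * (a * n) \<le> (1 - 8 * \<eta>) * N" using Nan \<eta> by (intro mult_left_mono) auto
      moreover have "(1 - 8 * \<eta>) * (a * n) = (a - c\<^sub>1 / 2) * n" using a by (simp add: \<eta>_def field_simps)
      ultimately have "(a - c\<^sub>1 / 2) * n < (a - c\<^sub>1) * n" by linarith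
      then show False using c1 n by simp
    qed
    with sE mE show ?thesis by blast
  qed
  moreover have "c / 2 > 0" using c by simp
  ultimately show ?thesis using \<epsilon> \<delta> by (intro bexI[of _ \<epsilon>] bexI[of _ \<delta>] exI[of _ "c / 2"]) auto
qed

end

subsection \<open>Measurability\<close>

text \<open>A countable dense set of the whole space may miss \<open>K\<close>; instead one point of
  \<open>B \<inter> K\<close> is picked for each basic open \<open>B\<close> that meets
  \<open>K\<close>.\<close>

lemma countable_dense_in:
  fixes K :: "'b::second_countable_topology set"
  obtains D where "countable D" "D \<subseteq> K" "\<And>U. open U \<Longrightarrow> U \<inter> K \<noteq> {} \<Longrightarrow> \<exists>d\<in>D. d \<in> U"
proof -
  obtain \<B> :: "'b set set" where \<B>: "countable \<B>" "topological_basis \<B>" using ex_countable_basis by blast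
  define f where "f B = (SOME x. x \<in> B \<inter> K)" for B
  have f: "f B \<in> B \<inter> K" if "B \<inter> K \<noteq> {}" for B
    using that unfolding f_def by (metis (no_types, lifting) ex_in_conv someI_ex)
  show ?thesis
  proof (rule that[of "f ` {B \<in> \<B>. B \<inter> K \<noteq> {}}"])
    fix U :: "'b set" assume U: "open U" "U \<inter> K \<noteq> {}"
    then obtain x where x: "x \<in> U" "x \<in> K" by blast
    from topological_basisE[OF \<B>(2) U(1) x(1)] obtain B where "B \<in> \<B>" "x \<in> B" "B \<subseteq> U" by blast
    then show "\<exists>d\<in>f ` {B \<in> \<B>. B \<inter> K \<noteq> {}}. d \<in> U" using f[of B] x by blast
  qed (use \<B> f in auto)
qed

text \<open>On a compact set a nonnegative continuous function has a zero iff its infimum is 0, and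
  by density the infimum is detected on a countable subset. The existential over uncountably many
  points thus becomes countable.\<close>

lemma sets_exists_zero:
  fixes F :: "'w \<Rightarrow> 'b::second_countable_topology \<Rightarrow> real"
  assumes K: "compact K"
    and cont: "\<And>\<omega>. \<omega> \<in> space M \<Longrightarrow> continuous_on K (F \<omega>)"
    and meas: "\<And>x. x \<in> K \<Longrightarrow> (\<lambda>\<omega>. F \<omega> x) \<in> borel_measurable M"
    and nonneg: "\<And>\<omega> x. F \<omega> x \<ge> 0"
  shows "{\<omega> \<in> space M. \<exists>x\<in>K. F \<omega> x = 0} \<in> sets M"
proof (cases "K = {}")
  case False
  obtain D where D: "countable D" "D \<subseteq> K" "\<And>U. open U \<Longrightarrow> U \<inter> K \<noteq> {} \<Longrightarrow> \<exists>d\<in>D. d \<in> U"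
    using countable_dense_in[of K] by blast
  have "(\<exists>x\<in>K. F \<omega> x = 0) \<longleftrightarrow> (\<forall>m::nat. \<exists>d\<in>D. F \<omega> d < 1 / (real m + 1))" if \<omega>: "\<omega> \<in> space M" for \<omega>
  proof
    assume "\<exists>x\<in>K. F \<omega> x = 0"
    then obtain x where x: "x \<in> K" "F \<omega> x = 0" by blast
    show "\<forall>m::nat. \<exists>d\<in>D. F \<omega> d < 1 / (real m + 1)"
    proof
      fix m :: nat
      obtain U where U: "open U" "U \<inter> K = F \<omega> -` {..<1 / (real m + 1)} \<inter> K"
        using cont[OF \<omega>] unfolding continuous_on_open_invariant by (meson open_lessThan)
      then have "x \<in> U \<inter> K" using x by auto
      then obtain d where "d \<in> D" "d \<in> U" using D(3)[OF U(1)] by blast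
      then show "\<exists>d\<in>D. F \<omega> d < 1 / (real m + 1)" using U(2) D(2) by blast
    qed
  next
    assume small: "\<forall>m::nat. \<exists>d\<in>D. F \<omega> d < 1 / (real m + 1)"
    obtain x where x: "x \<in> K" "\<And>y. y \<in> K \<Longrightarrow> F \<omega> x \<le> F \<omega> y"
      using continuous_attains_inf[OF K False cont[OF \<omega>]] by blast
    have "F \<omega> x = 0"
    proof (rule ccontr)
      assume "F \<omega> x \<noteq> 0"
      then have "F \<omega> x > 0" using nonneg[of \<omega> x] by simp
      then obtain m :: nat where "inverse (real (Suc m)) < F \<omega> x" using reals_Archimedean by blast
      moreover obtain d where "d \<in> D" "F \<omega> d < 1 / (real m + 1)" using small by blast
      ultimately show False using x(2)[of d] D(2) by (force simp: inverse_eq_divide add.commute)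
    qed
    with x(1) show "\<exists>x\<in>K. F \<omega> x = 0" by blast
  qed
  then have "{\<omega> \<in> space M. \<exists>x\<in>K. F \<omega> x = 0} = {\<omega> \<in> space M. \<forall>m::nat. \<exists>d\<in>D. F \<omega> d < 1 / (real m + 1)}"
    by blast
  also have "\<dots> \<in> sets M"
  proof -
    have [measurable]: "(\<lambda>\<omega>. F \<omega> d) \<in> borel_measurable M" if "d \<in> D" for d using meas that D(2) by blast
    show ?thesis
      using D(1) by (intro sets.sets_Collect_countable_All sets.sets_Collect_countable_Ex') measurable
  qed
  finally show ?thesis .
qed simp

text \<open>Vectors are total functions on the naturals, so this is Tychonoff for an infinite
  product.\<close>

lemma compact_cube: "compact (PiE UNIV (\<lambda>_::nat. {-1..1::real}))"
proof -
  have "compactin (product_topology (\<lambda>_::nat. euclidean :: real topology) UNIV) (PiE UNIV (\<lambda>_. {-1..1}))"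
    by (simp add: compactin_PiE)
  then show ?thesis by (simp add: euclidean_product_topology)
qed

section \<open>Elementary properties and measurability of the smallest singular value\<close>

lemma mat_vec_cong: "(\<And>j. j < n \<Longrightarrow> u j = u' j) \<Longrightarrow> mat_vec n A u i = mat_vec n A u' i"
  by (simp add: mat_vec_def)

lemma mat_vec_scale: "mat_vec n A (\<lambda>j. u j / r) = (\<lambda>i. mat_vec n A u i / r)"
  by (simp add: mat_vec_def sum_divide_distrib)

lemma L2_set_divide: "r > 0 \<Longrightarrow> L2_set (\<lambda>j. u j / r) S = L2_set u S / r"
  using L2_set_right_distrib[of "inverse r" u S] by (simp add: divide_inverse mult.commute)

lemma s_min_le:
  assumes "L2_set u {..<n} = 1"
  shows "s_min N n A \<le> L2_set (mat_vec n A u) {..<N}"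
  unfolding s_min_def
  by (rule cINF_lower) (use assms in \<open>auto intro!: bdd_belowI[of _ 0]\<close>)

lemma s_min_nonneg: "n \<ge> 1 \<Longrightarrow> s_min N n A \<ge> 0"
proof -
  assume n: "n \<ge> 1"
  have "L2_set (\<lambda>j. if j = 0 then 1 else 0) {..<n} = 1"
    using n by (simp add: L2_set_def if_distrib[of "\<lambda>x. x\<^sup>2"] cong: if_cong)
  then show ?thesis unfolding s_min_def by (intro cINF_greatest) auto
qed

text \<open>By homogeneity; in this form \<open>s_min\<close> meets the assumption on
  \<open>s\<close> in \<open>smallest_value_upper_bound\<close>.\<close>

lemma s_min_square_le:
  assumes n: "n \<ge> 1"
  shows "(s_min N n A)\<^sup>2 * (\<Sum>j<n. (w j)\<^sup>2) \<le> (\<Sum>i<N. (mat_vec n A w i)\<^sup>2)"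
proof (cases "L2_set w {..<n} = 0")
  case True
  then have "(\<Sum>j<n. (w j)\<^sup>2) = 0" by (simp add: L2_set_def)
  then show ?thesis by (simp add: sum_nonneg)
next
  case False
  define r where "r = L2_set w {..<n}"
  have r: "r > 0" using False L2_set_nonneg[of w "{..<n}"] by (simp add: r_def less_le)
  have "L2_set (\<lambda>j. w j / r) {..<n} = 1" using r by (simp add: L2_set_divide r_def)
  from s_min_le[OF this, of N A] have "s_min N n A * r \<le> L2_set (mat_vec n A w) {..<N}"
    using r by (simp add: mat_vec_scale L2_set_divide field_simps)
  then have "(s_min N n A * r)\<^sup>2 \<le> (L2_set (mat_vec n A w) {..<N})\<^sup>2"
    using r s_min_nonneg[OF n] by (intro power_mono) auto
  then show ?thesis by (simp add: power_mult_distrib r_def L2_set_def sum_nonneg)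
qed

lemma continuous_on_coordinate: "continuous_on S (\<lambda>u::nat \<Rightarrow> real. u j)"
  by (rule continuous_on_subset[OF continuous_on_product_coordinates]) simp

lemma continuous_on_L2_set:
  "(\<And>j. j \<in> I \<Longrightarrow> continuous_on S (\<lambda>u. f u j)) \<Longrightarrow> continuous_on S (\<lambda>u. L2_set (f u) I)"
  unfolding L2_set_def by (intro continuous_intros)

lemma continuous_on_mat_vec: "continuous_on S (\<lambda>u. mat_vec n A u i)"
  unfolding mat_vec_def by (intro continuous_intros continuous_on_coordinate)

lemma borel_measurable_L2_set:
  "(\<And>j. j \<in> I \<Longrightarrow> (\<lambda>\<omega>. f \<omega> j) \<in> borel_measurable M) \<Longrightarrow> (\<lambda>\<omega>. L2_set (f \<omega>) I) \<in> borel_measurable M"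
  unfolding L2_set_def by measurable

text \<open>A countable dense set need not contain unit vectors. Written homogeneously, the strict
  inequality is an open condition on all vectors of positive length, so testing a countable dense
  set suffices.\<close>

lemma borel_measurable_s_min:
  assumes n: "n \<ge> 1" and X: "\<And>i j. i < N \<Longrightarrow> j < n \<Longrightarrow> X i j \<in> borel_measurable M"
  shows "(\<lambda>\<omega>. s_min N n (\<lambda>i j. X i j \<omega>)) \<in> borel_measurable M"
proof -
  let ?A = "\<lambda>\<omega> i j. X i j \<omega>"
  obtain D :: "(nat \<Rightarrow> real) set" where D: "countable D" "\<And>U. open U \<Longrightarrow> U \<noteq> {} \<Longrightarrow> \<exists>d\<in>D. d \<in> U"
    using countable_dense_setE by blast
  have iff: "s_min N n (?A \<omega>) < c \<longleftrightarrow>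
    (\<exists>u\<in>D. 0 < L2_set u {..<n} \<and> L2_set (mat_vec n (?A \<omega>) u) {..<N} < c * L2_set u {..<n})" for \<omega> c
  proof
    assume lt: "s_min N n (?A \<omega>) < c"
    have "L2_set (\<lambda>j. if j = 0 then 1 else 0) {..<n} = 1"
      using n by (simp add: L2_set_def if_distrib[of "\<lambda>x. x\<^sup>2"] cong: if_cong)
    then have "{u. L2_set u {..<n} = 1} \<noteq> {}" by blast
    then obtain u where u: "L2_set u {..<n} = 1" "L2_set (mat_vec n (?A \<omega>) u) {..<N} < c"
      using lt unfolding s_min_def
      by (subst (asm) cINF_less_iff) (auto intro!: bdd_belowI[of _ 0])
    define U where "U = {u. 0 < L2_set u {..<n}} \<inter> {u. L2_set (mat_vec n (?A \<omega>) u) {..<N} < c * L2_set u {..<n}}"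
    have "open U" unfolding U_def
      by (intro open_Int open_Collect_less continuous_intros continuous_on_L2_set continuous_on_mat_vec continuous_on_coordinate)
    moreover have "u \<in> U" using u by (simp add: U_def)
    ultimately show "\<exists>u\<in>D. 0 < L2_set u {..<n} \<and> L2_set (mat_vec n (?A \<omega>) u) {..<N} < c * L2_set u {..<n}"
      using D(2)[of U] unfolding U_def by blast
  next
    assume "\<exists>u\<in>D. 0 < L2_set u {..<n} \<and> L2_set (mat_vec n (?A \<omega>) u) {..<N} < c * L2_set u {..<n}"
    then obtain u where u: "0 < L2_set u {..<n}" "L2_set (mat_vec n (?A \<omega>) u) {..<N} < c * L2_set u {..<n}" by blast
    have "L2_set (\<lambda>j. u j / L2_set u {..<n}) {..<n} = 1" using u by (simp add: L2_set_divide)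
    from s_min_le[OF this, of N "?A \<omega>"]
    have "s_min N n (?A \<omega>) \<le> L2_set (mat_vec n (?A \<omega>) u) {..<N} / L2_set u {..<n}"
      using u by (simp add: mat_vec_scale L2_set_divide)
    also have "\<dots> < c" using u by (simp add: pos_divide_less_eq)
    finally show "s_min N n (?A \<omega>) < c" .
  qed
  show ?thesis
    unfolding borel_measurable_iff_less
  proof
    fix c
    have [measurable]: "(\<lambda>\<omega>. L2_set (mat_vec n (?A \<omega>) u) {..<N}) \<in> borel_measurable M" for u
      unfolding mat_vec_def using X
      by (intro borel_measurable_L2_set borel_measurable_sum borel_measurable_times) auto
    show "{\<omega> \<in> space M. s_min N n (?A \<omega>) < c} \<in> sets M"
      unfolding iff using D(1) by (intro sets.sets_Collect_countable_Ex') measurable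
  qed
qed

text \<open>The pairs of left and right singular vectors are the zeros of a nonnegative continuous
  function on a compact cube. The strict inequality at \<open>\<delta>\<close> is not closed, so it
  is exhausted by the closed conditions with \<open>\<delta> - 1 / (real m + 1)\<close>.\<close>

lemma sets_localized_bottom_singular_vector:
  assumes n: "n \<ge> 1" and X: "\<And>i j. i < N \<Longrightarrow> j < n \<Longrightarrow> X i j \<in> borel_measurable M" and I: "I \<subseteq> {..<n}"
  shows "{\<omega> \<in> space M. \<exists>u. bottom_singular_vector N n (\<lambda>i j. X i j \<omega>) u \<and> L2_set u I < \<delta>} \<in> sets M"
proof -
  define s where "s \<omega> = s_min N n (\<lambda>i j. X i j \<omega>)" for \<omega>
  have s[measurable]: "s \<in> borel_measurable M"
    unfolding s_def[abs_def] using n X by (rule borel_measurable_s_min)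
  define Q where "Q = PiE UNIV (\<lambda>_::nat. {-1..1::real})"
  define F where "F m \<omega> z = \<bar>L2_set (fst z) {..<n} - 1\<bar> + \<bar>L2_set (snd z) {..<N} - 1\<bar>
      + (\<Sum>i<N. \<bar>mat_vec n (\<lambda>i j. X i j \<omega>) (fst z) i - s \<omega> * snd z i\<bar>)
      + (\<Sum>j<n. \<bar>mat_vec N (\<lambda>j i. X i j \<omega>) (snd z) j - s \<omega> * fst z j\<bar>)
      + max 0 (L2_set (fst z) I - (\<delta> - 1 / (real m + 1)))"
    for m :: nat and \<omega> and z :: "(nat \<Rightarrow> real) \<times> (nat \<Rightarrow> real)"
  have nonneg: "F m \<omega> z \<ge> 0" for m \<omega> z unfolding F_def by (intro add_nonneg_nonneg sum_nonneg) auto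
  have F0: "F m \<omega> (u, v) = 0 \<longleftrightarrow> L2_set u {..<n} = 1 \<and> L2_set v {..<N} = 1 \<and>
      (\<forall>i<N. mat_vec n (\<lambda>i j. X i j \<omega>) u i = s \<omega> * v i) \<and>
      (\<forall>j<n. mat_vec N (\<lambda>j i. X i j \<omega>) v j = s \<omega> * u j) \<and> L2_set u I \<le> \<delta> - 1 / (real m + 1)" for m \<omega> u v
  proof -
    have "p = 0 \<and> q = 0 \<and> r = 0 \<and> t = 0 \<and> w = 0 \<longleftrightarrow> p + q + r + t + w = 0"
      if "p \<ge> 0" "q \<ge> 0" "r \<ge> 0" "t \<ge> 0" "w \<ge> 0" for p q r t w :: real using that by linarith
    from this[of "\<bar>L2_set u {..<n} - 1\<bar>" "\<bar>L2_set v {..<N} - 1\<bar>"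
        "\<Sum>i<N. \<bar>mat_vec n (\<lambda>i j. X i j \<omega>) u i - s \<omega> * v i\<bar>"
        "\<Sum>j<n. \<bar>mat_vec N (\<lambda>j i. X i j \<omega>) v j - s \<omega> * u j\<bar>"
        "max 0 (L2_set u I - (\<delta> - 1 / (real m + 1)))"]
    have "F m \<omega> (u, v) = 0 \<longleftrightarrow> \<bar>L2_set u {..<n} - 1\<bar> = 0 \<and> \<bar>L2_set v {..<N} - 1\<bar> = 0 \<and>
        (\<Sum>i<N. \<bar>mat_vec n (\<lambda>i j. X i j \<omega>) u i - s \<omega> * v i\<bar>) = 0 \<and>
        (\<Sum>j<n. \<bar>mat_vec N (\<lambda>j i. X i j \<omega>) v j - s \<omega> * u j\<bar>) = 0 \<and>
        max 0 (L2_set u I - (\<delta> - 1 / (real m + 1))) = 0"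
      unfolding F_def fst_conv snd_conv by (simp only: sum_nonneg abs_ge_zero max.cobounded1 simp_thms)
    moreover have "(\<Sum>i<k. \<bar>f i - g i\<bar>) = 0 \<longleftrightarrow> (\<forall>i<k. f i = g i)" for f g :: "nat \<Rightarrow> real" and k
      by (subst sum_nonneg_eq_0_iff) auto
    moreover have "max 0 (x - y) = 0 \<longleftrightarrow> x \<le> y" for x y :: real by (simp add: max_def)
    moreover have "\<bar>x - 1\<bar> = 0 \<longleftrightarrow> x = 1" for x :: real by simp
    ultimately show ?thesis by (simp only:)
  qed
  \<comment> \<open>Irrelevant coordinates are set to 0, which moves a unit vector into the cube
    without affecting any condition.\<close>
  have unit: "\<exists>u'\<in>Q. \<forall>j<k. u' j = u j" if "L2_set u {..<k} = 1" for u :: "nat \<Rightarrow> real" and k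
  proof -
    have "\<bar>u j\<bar> \<le> 1" if "j < k" for j
      using member_le_L2_set[of "{..<k}" j "\<lambda>j. \<bar>u j\<bar>"] that \<open>L2_set u {..<k} = 1\<close> by (simp add: L2_set_def)
    then show ?thesis
      by (intro bexI[of _ "\<lambda>j. if j < k then u j else 0"]) (auto simp: Q_def abs_le_iff)
  qed
  have "(\<exists>u. bottom_singular_vector N n (\<lambda>i j. X i j \<omega>) u \<and> L2_set u I < \<delta>) \<longleftrightarrow>
      (\<exists>m. \<exists>z\<in>Q \<times> Q. F m \<omega> z = 0)" for \<omega>
  proof
    assume "\<exists>u. bottom_singular_vector N n (\<lambda>i j. X i j \<omega>) u \<and> L2_set u I < \<delta>"
    then obtain u v where u: "L2_set u {..<n} = 1" "L2_set v {..<N} = 1"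
      "\<And>i. i < N \<Longrightarrow> mat_vec n (\<lambda>i j. X i j \<omega>) u i = s \<omega> * v i"
      "\<And>j. j < n \<Longrightarrow> mat_vec N (\<lambda>j i. X i j \<omega>) v j = s \<omega> * u j" "L2_set u I < \<delta>"
      unfolding bottom_singular_vector_def right_singular_vector_def s_def by blast
    obtain u' where u': "u' \<in> Q" "\<And>j. j < n \<Longrightarrow> u' j = u j" using unit[OF u(1)] by blast
    obtain v' where v': "v' \<in> Q" "\<And>j. j < N \<Longrightarrow> v' j = v j" using unit[OF u(2)] by blast
    obtain m where m: "inverse (real (Suc m)) < \<delta> - L2_set u I"
      using reals_Archimedean[of "\<delta> - L2_set u I"] u(5) by auto
    have "L2_set u' {..<n} = L2_set u {..<n}" "L2_set v' {..<N} = L2_set v {..<N}" "L2_set u' I = L2_set u I"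
      using u' v' I by (auto intro!: L2_set_cong)
    moreover have "mat_vec n (\<lambda>i j. X i j \<omega>) u' i = mat_vec n (\<lambda>i j. X i j \<omega>) u i"
      "mat_vec N (\<lambda>j i. X i j \<omega>) v' j = mat_vec N (\<lambda>j i. X i j \<omega>) v j" for i j
      using u' v' by (auto intro!: mat_vec_cong)
    moreover have "L2_set u I \<le> \<delta> - 1 / (real m + 1)"
      using m by (simp add: inverse_eq_divide add.commute)
    ultimately have "F m \<omega> (u', v') = 0"
      unfolding F0 using u(1-4) u'(2) v'(2) by simp
    then show "\<exists>m. \<exists>z\<in>Q \<times> Q. F m \<omega> z = 0" using u' v' by blast
  next
    assume "\<exists>m. \<exists>z\<in>Q \<times> Q. F m \<omega> z = 0"
    then obtain m u v where F: "F m \<omega> (u, v) = 0" by auto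
    have "1 / (real m + 1) > 0" by simp
    then have "L2_set u I < \<delta>" using F unfolding F0 by linarith
    moreover have "bottom_singular_vector N n (\<lambda>i j. X i j \<omega>) u"
      unfolding bottom_singular_vector_def right_singular_vector_def using F unfolding F0 s_def by blast
    ultimately show "\<exists>u. bottom_singular_vector N n (\<lambda>i j. X i j \<omega>) u \<and> L2_set u I < \<delta>" by blast
  qed
  then have "{\<omega> \<in> space M. \<exists>u. bottom_singular_vector N n (\<lambda>i j. X i j \<omega>) u \<and> L2_set u I < \<delta>}
      = (\<Union>m. {\<omega> \<in> space M. \<exists>z\<in>Q \<times> Q. F m \<omega> z = 0})" by auto
  also have "\<dots> \<in> sets M"
  proof (intro sets.countable_UN subsetI, clarify)
    fix m
    show "{\<omega> \<in> space M. \<exists>z\<in>Q \<times> Q. F m \<omega> z = 0} \<in> sets M"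
    proof (rule sets_exists_zero)
      show "compact (Q \<times> Q)" unfolding Q_def by (intro compact_Times compact_cube)
      have c1: "continuous_on S (\<lambda>z. fst z j)" and c2: "continuous_on S (\<lambda>z. snd z j)"
        for S :: "((nat \<Rightarrow> real) \<times> (nat \<Rightarrow> real)) set" and j
        by (rule continuous_on_compose2[OF continuous_on_coordinate[of UNIV j]],
            auto intro: continuous_on_fst continuous_on_snd continuous_on_id)+
      show "continuous_on (Q \<times> Q) (F m \<omega>)" for \<omega>
        unfolding F_def mat_vec_def
        by (intro continuous_intros continuous_on_L2_set c1 c2)
      have "(\<lambda>\<omega>. mat_vec n (\<lambda>i j. X i j \<omega>) u i) \<in> borel_measurable M" if "i < N" for u i
        unfolding mat_vec_def using X that by (intro borel_measurable_sum borel_measurable_times) auto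
      moreover have "(\<lambda>\<omega>. mat_vec N (\<lambda>j i. X i j \<omega>) v j) \<in> borel_measurable M" if "j < n" for v j
        unfolding mat_vec_def using X that by (intro borel_measurable_sum borel_measurable_times) auto
      ultimately show "(\<lambda>\<omega>. F m \<omega> z) \<in> borel_measurable M" for z
        unfolding F_def
        by (intro borel_measurable_add borel_measurable_sum borel_measurable_abs borel_measurable_diff
            borel_measurable_times s borel_measurable_const) auto
    qed (rule nonneg)
  qed
  finally show ?thesis .
qed

subsection \<open>Rows and columns of an iid matrix\<close>

text \<open>Each index \<open>j\<close> becomes the singleton block \<open>{f j}\<close>;
  injectivity makes the blocks disjoint.\<close>

lemma (in prob_space) indep_vars_reindex:
  assumes X: "indep_vars M' X I" and f: "inj_on f J" "f ` J \<subseteq> I"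
  shows "indep_vars (\<lambda>j. M' (f j)) (\<lambda>j. X (f j)) J"
proof -
  have "indep_vars (\<lambda>j. PiM {f j} M') (\<lambda>j \<omega>. restrict (\<lambda>i. X i \<omega>) {f j}) J"
    using f by (intro indep_vars_restrict[OF X]) (auto simp: disjoint_family_on_def inj_on_def)
  from indep_vars_compose2[OF this, where N = "\<lambda>j. M' (f j)" and Y = "\<lambda>j r. r (f j)"]
  show ?thesis by simp
qed

text \<open>Lets one statement about rows also serve for columns, which the greedy argument
  needs.\<close>

lemma iid_matrix_transpose:
  assumes "iid_matrix M \<mu> N n X"
  shows "iid_matrix M \<mu> n N (\<lambda>j i. X i j)"
proof -
  interpret prob_space M using assms by (simp add: iid_matrix_def)
  have ind: "indep_vars (\<lambda>_. borel) (\<lambda>(i, j). X i j) ({..<N} \<times> {..<n})"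
    using assms by (simp add: iid_matrix_def)
  have "indep_vars (\<lambda>_. borel) (\<lambda>p. (\<lambda>(i, j). X i j) (prod.swap p)) ({..<n} \<times> {..<N})"
    by (rule indep_vars_reindex[OF ind]) auto
  also have "(\<lambda>p. (\<lambda>(i, j). X i j) (prod.swap p)) = (\<lambda>(j, i). X i j)" by auto
  finally show ?thesis using assms unfolding iid_matrix_def by blast
qed

context symmetric_unit_law
begin

text \<open>Independence is used at two levels: within a row it gives the product law
  \<open>vec_law n\<close>, and between the disjoint blocks of entries it gives the product over
  rows.\<close>

lemma iid_matrix_rows:
  assumes iid: "iid_matrix M \<mu> N n X" and N: "N \<ge> 1" and n: "n \<ge> 1"
  shows "(\<lambda>\<omega>. \<lambda>i\<in>{..<N}. \<lambda>j\<in>{..<n}. X i j \<omega>) \<in> measurable M (mat_law N n)"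
    and "distr M (mat_law N n) (\<lambda>\<omega>. \<lambda>i\<in>{..<N}. \<lambda>j\<in>{..<n}. X i j \<omega>) = mat_law N n"
proof -
  interpret M: prob_space M using iid by (simp add: iid_matrix_def)
  have ind: "M.indep_vars (\<lambda>_. borel) (\<lambda>(i, j). X i j) ({..<N} \<times> {..<n})" using iid by (simp add: iid_matrix_def)
  have law: "distr M borel (X i j) = \<mu>" if "i < N" "j < n" for i j using iid that by (simp add: iid_matrix_def)
  have X: "X i j \<in> borel_measurable M" if "i < N" "j < n" for i j
    using ind that unfolding M.indep_vars_def by force
  let ?B = "PiM {..<n} (\<lambda>_. borel :: real measure)"
  have sets_B: "sets ?B = sets (vec_law n)" by (intro sets_PiM_cong refl) (simp add: sets_law)
  define R where "R i \<omega> = (\<lambda>j\<in>{..<n}. X i j \<omega>)" for i \<omega>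
  have R: "R i \<in> measurable M ?B" if "i < N" for i
    unfolding R_def using X that by (intro measurable_restrict) auto
  have row: "distr M ?B (R i) = vec_law n" if i: "i < N" for i
  proof -
    have "M.indep_vars (\<lambda>_. borel) (\<lambda>j. (\<lambda>(i, j). X i j) (i, j)) {..<n}"
      using i by (intro M.indep_vars_reindex[OF ind]) (auto simp: inj_on_def)
    then have row_ind: "M.indep_vars (\<lambda>_. borel) (X i) {..<n}" by simp
    have ne: "{..<n} \<noteq> {}" using n by (auto simp: lessThan_empty_iff)
    have "distr M ?B (\<lambda>\<omega>. \<lambda>j\<in>{..<n}. X i j \<omega>) = PiM {..<n} (\<lambda>j. distr M borel (X i j))"
      by (rule M.indep_vars_iff_distr_eq_PiM'[THEN iffD1, OF ne _ row_ind]) (use X i in simp)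
    also have "\<dots> = vec_law n" using law i by (intro PiM_cong) auto
    finally show ?thesis unfolding R_def .
  qed
  have "M.indep_vars (\<lambda>i. PiM ({i} \<times> {..<n}) (\<lambda>_. borel))
      (\<lambda>i \<omega>. restrict (\<lambda>p. (case p of (i, j) \<Rightarrow> X i j) \<omega>) ({i} \<times> {..<n})) {..<N}"
    by (rule M.indep_vars_restrict[OF ind]) (auto simp: disjoint_family_on_def)
  from M.indep_vars_compose2[OF this, where N = "\<lambda>_. ?B" and Y = "\<lambda>i r. \<lambda>j\<in>{..<n}. r (i, j)"]
  have "M.indep_vars (\<lambda>_. ?B) (\<lambda>i \<omega>. \<lambda>j\<in>{..<n}.
      restrict (\<lambda>p. (case p of (i, j) \<Rightarrow> X i j) \<omega>) ({i} \<times> {..<n}) (i, j)) {..<N}"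
    by (auto intro!: measurable_restrict measurable_component_singleton)
  also have "(\<lambda>i \<omega>. \<lambda>j\<in>{..<n}.
      restrict (\<lambda>p. (case p of (i, j) \<Rightarrow> X i j) \<omega>) ({i} \<times> {..<n}) (i, j)) = R"
    unfolding R_def by (intro ext restrict_ext) simp
  finally have R_ind: "M.indep_vars (\<lambda>_. ?B) R {..<N}" .
  have ne: "{..<N} \<noteq> {}" using N by (auto simp: lessThan_empty_iff)
  have "distr M (PiM {..<N} (\<lambda>_. ?B)) (\<lambda>\<omega>. \<lambda>i\<in>{..<N}. R i \<omega>) = PiM {..<N} (\<lambda>i. distr M ?B (R i))"
    by (rule M.indep_vars_iff_distr_eq_PiM'[THEN iffD1, OF ne _ R_ind]) (use R in simp)
  also have "\<dots> = mat_law N n" using row by (intro PiM_cong) auto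
  finally have *: "distr M (PiM {..<N} (\<lambda>_. ?B)) (\<lambda>\<omega>. \<lambda>i\<in>{..<N}. R i \<omega>) = mat_law N n" .
  have sets_BB: "sets (PiM {..<N} (\<lambda>_. ?B)) = sets (mat_law N n)" by (intro sets_PiM_cong refl sets_B)
  have "distr M (mat_law N n) (\<lambda>\<omega>. \<lambda>i\<in>{..<N}. R i \<omega>) = distr M (PiM {..<N} (\<lambda>_. ?B)) (\<lambda>\<omega>. \<lambda>i\<in>{..<N}. R i \<omega>)"
    using sets_BB by (intro distr_cong) auto
  then show "distr M (mat_law N n) (\<lambda>\<omega>. \<lambda>i\<in>{..<N}. \<lambda>j\<in>{..<n}. X i j \<omega>) = mat_law N n"
    using * by (simp add: R_def)
  have "(\<lambda>\<omega>. \<lambda>i\<in>{..<N}. R i \<omega>) \<in> measurable M (PiM {..<N} (\<lambda>_. ?B))" using R by (intro measurable_restrict) auto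
  moreover have "measurable M (PiM {..<N} (\<lambda>_. ?B)) = measurable M (mat_law N n)"
    by (rule measurable_cong_sets[OF refl sets_BB])
  ultimately show "(\<lambda>\<omega>. \<lambda>i\<in>{..<N}. \<lambda>j\<in>{..<n}. X i j \<omega>) \<in> measurable M (mat_law N n)"
    unfolding R_def by blast
qed

end

section \<open>Combining the two bounds\<close>

lemma exponential_le_powr:
  fixes K c d :: real
  assumes "c > 0" "d > 0" "K > 0"
  shows "\<exists>D>0. \<forall>n\<ge>1. exp (- c * real n) + exp (- d * real n) \<le> D * real n powr (- K)"
proof -
  have "(\<lambda>n. real n powr K * exp (- c * real n)) \<longlonglongrightarrow> 0"
    "(\<lambda>n. real n powr K * exp (- d * real n)) \<longlonglongrightarrow> 0"
    using assms by real_asymp+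
  from tendsto_add[OF this]
  have "(\<lambda>n. real n powr K * (exp (- c * real n) + exp (- d * real n))) \<longlonglongrightarrow> 0"
    by (simp add: distrib_left)
  then have "Bseq (\<lambda>n. real n powr K * (exp (- c * real n) + exp (- d * real n)))"
    by (intro convergent_imp_Bseq convergentI)
  then obtain D where D: "D > 0" "\<And>n. norm (real n powr K * (exp (- c * real n) + exp (- d * real n))) \<le> D"
    by (elim BseqE) blast
  have "exp (- c * real n) + exp (- d * real n) \<le> D * real n powr (- K)" if "n \<ge> 1" for n
  proof -
    have "real n powr K * (exp (- c * real n) + exp (- d * real n)) \<le> D" using D(2)[of n] by simp
    then show ?thesis using that by (simp add: powr_minus field_simps)
  qed
  with D(1) show ?thesis by blast
qed

theorem theorem1p10:
  fixes a \<alpha> C\<^sub>l C\<^sub>u T\<^sub>0 :: real and \<mu> :: "real measure"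
  assumes "a > 1"
    and "prob_space \<mu>" and "sets \<mu> = sets borel"
    and "C\<^sub>l > 0" and "C\<^sub>u > 0" and "T\<^sub>0 > 0" and "\<alpha> > 2"
    and "\<And>t. t \<ge> T\<^sub>0 \<Longrightarrow> C\<^sub>l * t powr (-\<alpha>) \<le> measure \<mu> {x. \<bar>x\<bar> > t}"
    and "\<And>t. t \<ge> T\<^sub>0 \<Longrightarrow> measure \<mu> {x. \<bar>x\<bar> > t} \<le> C\<^sub>u * t powr (-\<alpha>)"
    and "integrable \<mu> (\<lambda>x. x^2)" and "(\<integral>x. x^2 \<partial>\<mu>) = 1"
    and "distr \<mu> borel (\<lambda>x. - x) = \<mu>"
  shows "\<forall>K::real. K > 0 \<longrightarrow>
    (\<exists>\<epsilon>\<^sub>a\<in>{0<..<1/2}. \<exists>\<delta>\<^sub>a\<in>{0<..<1/2}. \<exists>C>0.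
      \<forall>n\<ge>1. \<forall>N (M :: 'w measure) X.
        N = nat \<lceil>a * real n\<rceil> \<longrightarrow> iid_matrix M \<mu> N n X \<longrightarrow>
        measure M {\<omega>\<in>space M.
            \<forall>u. bottom_singular_vector N n (\<lambda>i j. X i j \<omega>) u \<longrightarrow>
              (\<forall>\<epsilon>\<in>{0<..<\<epsilon>\<^sub>a}. \<forall>I\<subseteq>{..<n}.
                 card I = nat \<lceil>(1 - \<epsilon>) * real n\<rceil> \<longrightarrow> L2_set u I \<ge> \<delta>\<^sub>a)}
          \<ge> 1 - C * real n powr (-K))"
proof (intro allI impI)
  fix K :: real assume K: "K > 0"
  interpret prob_space \<mu> by (rule assms(2))
  interpret symmetric_unit_law \<mu> by unfold_locales (fact assms)+
  obtain c\<^sub>1 c n\<^sub>0 where c1: "c\<^sub>1 > 0" "c\<^sub>1 \<le> a" and c: "c > 0"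
    and up: "\<forall>n\<ge>n\<^sub>0. \<forall>N. N = nat \<lceil>a * real n\<rceil> \<longrightarrow>
    (\<exists>E\<in>sets (mat_law n N). measure (mat_law n N) E \<le> exp (- c * n) \<and>
      (\<forall>x\<in>space (mat_law n N) - E. \<forall>s\<ge>0.
        (\<forall>w. s\<^sup>2 * (\<Sum>l<n. (w l)\<^sup>2) \<le> (\<Sum>i<N. (\<Sum>l<n. w l * x l i)\<^sup>2)) \<longrightarrow> s\<^sup>2 \<le> (a - c\<^sub>1) * n))"
    using smallest_value_upper_bound[OF assms(1)] by (elim exE conjE) (rule that)
  obtain \<epsilon>\<^sub>a \<delta>\<^sub>a d where \<epsilon>\<^sub>a: "\<epsilon>\<^sub>a \<in> {0<..<1/2}" and \<delta>\<^sub>a: "\<delta>\<^sub>a \<in> {0<..<1/2}" and d: "d > 0"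
    and low: "\<forall>n\<ge>1. \<forall>N. N = nat \<lceil>a * real n\<rceil> \<longrightarrow>
    (\<exists>E\<in>sets (mat_law N n). measure (mat_law N n) E \<le> exp (- d * n) \<and>
      (\<forall>x\<in>space (mat_law N n) - E. \<forall>u I.
        (\<Sum>j<n. (u j)\<^sup>2) = 1 \<longrightarrow> I \<subseteq> {..<n} \<longrightarrow> real (card ({..<n} - I)) \<le> \<epsilon>\<^sub>a * n \<longrightarrow> L2_set u I < \<delta>\<^sub>a \<longrightarrow>
        (a - c\<^sub>1) * n < (\<Sum>i<N. (\<Sum>j<n. x i j * u j)\<^sup>2)))"
    using compressible_lower_bound[OF assms(1) c1] by (elim exE conjE bexE) (rule that)
  obtain D where D: "D > 0" "\<And>n. n \<ge> 1 \<Longrightarrow> exp (- c * real n) + exp (- d * real n) \<le> D * real n powr (- K)"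
    using exponential_le_powr[OF c d K] by blast
  define C where "C = D + real n\<^sub>0 powr K"
  have C: "C > 0" using D by (simp add: C_def add_pos_nonneg)
  have "1 - C * real n powr (-K) \<le> measure M {\<omega>\<in>space M.
            \<forall>u. bottom_singular_vector N n (\<lambda>i j. X i j \<omega>) u \<longrightarrow>
              (\<forall>\<epsilon>\<in>{0<..<\<epsilon>\<^sub>a}. \<forall>I\<subseteq>{..<n}.
                 card I = nat \<lceil>(1 - \<epsilon>) * real n\<rceil> \<longrightarrow> L2_set u I \<ge> \<delta>\<^sub>a)}" (is "_ \<le> measure M ?T")
    if n: "n \<ge> 1" and N: "N = nat \<lceil>a * real n\<rceil>" and iid: "iid_matrix M \<mu> N n X"
    for n N and M :: "'w measure" and X
  proof (cases "n \<ge> n\<^sub>0")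
    case False
    then have "real n powr K \<le> real n\<^sub>0 powr K" using K by (intro powr_mono2) auto
    also have "\<dots> \<le> C" using D by (simp add: C_def)
    finally have "1 \<le> C * real n powr (-K)" using n by (simp add: powr_minus field_simps)
    then show ?thesis by (smt (verit) measure_nonneg)
  next
    case True
    interpret M: prob_space M using iid by (simp add: iid_matrix_def)
    have "1 * real n \<le> a * n" using assms(1) by (intro mult_right_mono) auto
    then have N1: "N \<ge> 1" using n unfolding N by linarith
    have X: "X i j \<in> borel_measurable M" if "i < N" "j < n" for i j
      using iid that unfolding iid_matrix_def M.indep_vars_def by force
    \<comment> \<open>\<open>V\<close> reads the matrix by rows for the lower bound,
      \<open>W\<close> reads the same entries by columns for the greedy bound; the two bad events
      are joined by a union bound.\<close>
    define V where "V \<omega> = (\<lambda>i\<in>{..<N}. \<lambda>j\<in>{..<n}. X i j \<omega>)" for \<omega>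
    define W where "W \<omega> = (\<lambda>j\<in>{..<n}. \<lambda>i\<in>{..<N}. X i j \<omega>)" for \<omega>
    have V: "V \<in> measurable M (mat_law N n)" "distr M (mat_law N n) V = mat_law N n"
      using iid_matrix_rows[OF iid N1 n] by (simp_all add: V_def[abs_def])
    have W: "W \<in> measurable M (mat_law n N)" "distr M (mat_law n N) W = mat_law n N"
      using iid_matrix_rows[OF iid_matrix_transpose[OF iid] n N1] by (simp_all add: W_def[abs_def])
    obtain E where E: "E \<in> sets (mat_law n N)" "measure (mat_law n N) E \<le> exp (- c * n)"
      "\<And>x s. x \<in> space (mat_law n N) - E \<Longrightarrow> s \<ge> 0 \<Longrightarrow>
        (\<And>w. s\<^sup>2 * (\<Sum>l<n. (w l)\<^sup>2) \<le> (\<Sum>i<N. (\<Sum>l<n. w l * x l i)\<^sup>2)) \<Longrightarrow> s\<^sup>2 \<le> (a - c\<^sub>1) * n"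
      using up[rule_format, OF True N] by blast
    obtain F where F: "F \<in> sets (mat_law N n)" "measure (mat_law N n) F \<le> exp (- d * n)"
      "\<And>x u I. x \<in> space (mat_law N n) - F \<Longrightarrow> (\<Sum>j<n. (u j)\<^sup>2) = 1 \<Longrightarrow> I \<subseteq> {..<n} \<Longrightarrow>
        real (card ({..<n} - I)) \<le> \<epsilon>\<^sub>a * n \<Longrightarrow> L2_set u I < \<delta>\<^sub>a \<Longrightarrow>
        (a - c\<^sub>1) * n < (\<Sum>i<N. (\<Sum>j<n. x i j * u j)\<^sup>2)"
      using low[rule_format, OF n N] by blast
    define B where "B = (W -` E \<inter> space M) \<union> (V -` F \<inter> space M)"
    have sB: "B \<in> sets M" unfolding B_def using V(1) W(1) E(1) F(1) by (intro sets.Un measurable_sets)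
    have "measure M B \<le> measure M (W -` E \<inter> space M) + measure M (V -` F \<inter> space M)"
      unfolding B_def using V(1) W(1) E(1) F(1) by (intro measure_Un_le measurable_sets)
    also have "measure M (W -` E \<inter> space M) = measure (mat_law n N) E"
      using measure_distr[OF W(1) E(1)] W(2) by simp
    also have "measure M (V -` F \<inter> space M) = measure (mat_law N n) F"
      using measure_distr[OF V(1) F(1)] V(2) by simp
    also have "measure (mat_law n N) E + measure (mat_law N n) F \<le> D * real n powr (- K)"
      using E(2) F(2) D(2)[OF n] by linarith
    also have "\<dots> \<le> C * real n powr (- K)" by (intro mult_right_mono) (auto simp: C_def)
    finally have mB: "measure M B \<le> C * real n powr (- K)" .
    have sub: "space M - B \<subseteq> ?T"
    proof (intro subsetI CollectI conjI allI impI ballI)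
      fix \<omega> assume \<omega>: "\<omega> \<in> space M - B"
      then show "\<omega> \<in> space M" by simp
      fix u \<epsilon> I
      assume u: "bottom_singular_vector N n (\<lambda>i j. X i j \<omega>) u" and \<epsilon>: "\<epsilon> \<in> {0<..<\<epsilon>\<^sub>a}"
        and I: "I \<subseteq> {..<n}" and card: "card I = nat \<lceil>(1 - \<epsilon>) * real n\<rceil>"
      define s where "s = s_min N n (\<lambda>i j. X i j \<omega>)"
      have W\<omega>: "W \<omega> \<in> space (mat_law n N) - E" and V\<omega>: "V \<omega> \<in> space (mat_law N n) - F"
        using \<omega> measurable_space[OF W(1)] measurable_space[OF V(1)] by (auto simp: B_def)
      have s_le: "s\<^sup>2 \<le> (a - c\<^sub>1) * n"
      proof (rule E(3)[OF W\<omega>])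
        show "s \<ge> 0" unfolding s_def by (rule s_min_nonneg[OF n])
        fix w :: "nat \<Rightarrow> real"
        have "s\<^sup>2 * (\<Sum>l<n. (w l)\<^sup>2) \<le> (\<Sum>i<N. (mat_vec n (\<lambda>i j. X i j \<omega>) w i)\<^sup>2)"
          unfolding s_def by (rule s_min_square_le[OF n])
        also have "\<dots> = (\<Sum>i<N. (\<Sum>l<n. w l * W \<omega> l i)\<^sup>2)"
          unfolding mat_vec_def by (intro sum.cong arg_cong[where f = "\<lambda>x. x\<^sup>2"]) (auto simp: W_def)
        finally show "s\<^sup>2 * (\<Sum>l<n. (w l)\<^sup>2) \<le> (\<Sum>i<N. (\<Sum>l<n. w l * W \<omega> l i)\<^sup>2)" .
      qed
      obtain v where uv: "L2_set u {..<n} = 1" "L2_set v {..<N} = 1"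
        "\<And>i. i < N \<Longrightarrow> mat_vec n (\<lambda>i j. X i j \<omega>) u i = s * v i"
        using u unfolding bottom_singular_vector_def right_singular_vector_def s_def by blast
      have "(\<Sum>i<N. (\<Sum>j<n. V \<omega> i j * u j)\<^sup>2) = (\<Sum>i<N. (mat_vec n (\<lambda>i j. X i j \<omega>) u i)\<^sup>2)"
        unfolding mat_vec_def by (intro sum.cong arg_cong[where f = "\<lambda>x. x\<^sup>2"]) (auto simp: V_def)
      also have "\<dots> = s\<^sup>2 * (\<Sum>i<N. (v i)\<^sup>2)"
        unfolding sum_distrib_left by (intro sum.cong) (auto simp: uv(3) power_mult_distrib)
      also have "(\<Sum>i<N. (v i)\<^sup>2) = 1" using uv(2) by (simp add: L2_set_def)
      \<comment> \<open>A bottom singular vector attains \<open>s_min\<close>, so its image has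
        squared length exactly s^2; were it small on \<open>I\<close>, this would exceed the upper
        bound on s^2.\<close>
      finally have Vu: "(\<Sum>i<N. (\<Sum>j<n. V \<omega> i j * u j)\<^sup>2) = s\<^sup>2" by simp
      have "(\<Sum>j<n. (u j)\<^sup>2) = 1" using uv(1) by (simp add: L2_set_def)
      moreover have "real (card ({..<n} - I)) \<le> \<epsilon>\<^sub>a * n"
      proof -
        have "card ({..<n} - I) = n - card I" using I by (simp add: card_Diff_subset finite_subset)
        moreover have "card I \<le> n" using card_mono[OF _ I] by simp
        moreover have "real (card I) \<ge> (1 - \<epsilon>) * n" unfolding card by linarith
        ultimately have "real (card ({..<n} - I)) \<le> \<epsilon> * n" by (simp add: of_nat_diff algebra_simps)
        also have "\<dots> \<le> \<epsilon>\<^sub>a * n" using \<epsilon> by (intro mult_right_mono) auto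
        finally show ?thesis .
      qed
      ultimately show "\<delta>\<^sub>a \<le> L2_set u I" using F(3)[OF V\<omega> _ I, of u] s_le Vu by linarith
    qed
    \<comment> \<open>Monotonicity of the measure requires this. Although \<open>\<epsilon>\<close>
      ranges over an interval, only finitely many sets \<open>I\<close> occur, so the failure event
      is a finite union of measurable ones.\<close>
    have sT: "?T \<in> sets M"
    proof -
      define \<I> where "\<I> = {I. I \<subseteq> {..<n} \<and> (\<exists>\<epsilon>\<in>{0<..<\<epsilon>\<^sub>a}. card I = nat \<lceil>(1 - \<epsilon>) * real n\<rceil>)}"
      have "finite \<I>" unfolding \<I>_def by (rule finite_subset[of _ "Pow {..<n}"]) auto
      then have "(\<Union>I\<in>\<I>. {\<omega>\<in>space M. \<exists>u. bottom_singular_vector N n (\<lambda>i j. X i j \<omega>) u \<and> L2_set u I < \<delta>\<^sub>a}) \<in> sets M"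
        using n X by (intro sets.finite_UN sets_localized_bottom_singular_vector) (auto simp: \<I>_def)
      moreover have "?T = space M -
          (\<Union>I\<in>\<I>. {\<omega>\<in>space M. \<exists>u. bottom_singular_vector N n (\<lambda>i j. X i j \<omega>) u \<and> L2_set u I < \<delta>\<^sub>a})"
        unfolding \<I>_def by (auto simp: not_le[symmetric])
      ultimately show ?thesis by auto
    qed
    have "1 - measure M B = measure M (space M - B)" using M.prob_compl[OF sB] by simp
    also have "\<dots> \<le> measure M ?T" by (rule M.finite_measure_mono[OF sub sT])
    finally show ?thesis using mB by linarith
  qed
  with C \<delta>\<^sub>a \<epsilon>\<^sub>a show "\<exists>\<epsilon>\<^sub>a\<in>{0<..<1/2}. \<exists>\<delta>\<^sub>a\<in>{0<..<1/2}. \<exists>C>0.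
      \<forall>n\<ge>1. \<forall>N (M :: 'w measure) X.
        N = nat \<lceil>a * real n\<rceil> \<longrightarrow> iid_matrix M \<mu> N n X \<longrightarrow>
        measure M {\<omega>\<in>space M.
            \<forall>u. bottom_singular_vector N n (\<lambda>i j. X i j \<omega>) u \<longrightarrow>
              (\<forall>\<epsilon>\<in>{0<..<\<epsilon>\<^sub>a}. \<forall>I\<subseteq>{..<n}.
                 card I = nat \<lceil>(1 - \<epsilon>) * real n\<rceil> \<longrightarrow> L2_set u I \<ge> \<delta>\<^sub>a)}
          \<ge> 1 - C * real n powr (-K)"
    by (intro bexI[of _ \<epsilon>\<^sub>a] bexI[of _ \<delta>\<^sub>a] exI[of _ C] conjI allI impI)
qed

end
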